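(* For a positive integer $n$, let $\varrho=\varrho(n)=\max\{\rho(G)\mid G \text{ is a planar graph of order } n\}$, where $\rho(G)$ denotes the spectral radius (largest eigenvalue of the adjacency matrix) of $G$. Then: (1) $1.359+\sqrt{2n-\frac{15}{4}}<\varrho< 2+\sqrt{2n-6}$ for $n\geq 10$; (2) $1.472+\sqrt{2n-\frac{15}{4}}<\varrho< 2+\sqrt{2n-6}$ for $n\geq 40$; (3) $1.478+\sqrt{2n-\frac{15}{4}}<\varrho< 2+\sqrt{2n-6}$ for $n\geq 50$.
   Context: All graphs are finite, simple and undirected. The spectral radius $\rho(G)$ of a graph $G$ is the largest eigenvalue of its adjacency matrix $A_G$. *)

theory Defs
  imports
    "HOL-Analysis.Path_Connected"
    "Graph_Theory.Pair_Digraph"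
    "Jordan_Normal_Form.Char_Poly"
begin

text \<open>
  A finite simple undirected graph is a \<^locale>\<open>pair_graph\<close>: a finite loopless digraph with a
  symmetric set of arcs, so that an edge \<open>{u, v}\<close> is represented by the two arcs
  \<open>(u, v)\<close> and \<open>(v, u)\<close>.
\<close>

text \<open>
  The linear order on the vertices only serves to number the rows and columns; different
  numberings give similar matrices.
\<close>

definition adjacency_matrix :: "'a::linorder pair_pre_digraph \<Rightarrow> real mat" where
  "adjacency_matrix G =
    (let vs = sorted_list_of_set (pverts G); n = card (pverts G)
     in mat n n (\<lambda>(i, j). if (vs ! i, vs ! j) \<in> parcs G then 1 else 0))"

text \<open>
  The eigenvalues are the real ones. Since the matrix is symmetric these are all of its
  eigenvalues, and for a nonempty graph the set is finite and nonempty.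
\<close>

definition graph_spectral_radius :: "'a::linorder pair_pre_digraph \<Rightarrow> real" where
  "graph_spectral_radius G = Max {k. eigenvalue (adjacency_matrix G) k}"

text \<open>
  A drawing in the plane, here \<^typ>\<open>complex\<close>: \<open>p\<close> places the vertices and
  \<open>\<gamma> {u, v}\<close> is the simple arc representing the edge \<open>{u, v}\<close>, traversed in either
  direction. An edge meets the vertex set only in its two ends, and two different edges meet only
  in the ends they share.
\<close>

definition plane_drawing ::
  "'a pair_pre_digraph \<Rightarrow> ('a \<Rightarrow> complex) \<Rightarrow> ('a set \<Rightarrow> real \<Rightarrow> complex) \<Rightarrow> bool" where
  "plane_drawing G p \<gamma> \<longleftrightarrow>
    inj_on p (pverts G) \<and>
    (\<forall>(u, v)\<in>parcs G.
        arc (\<gamma> {u, v}) \<and>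
        {pathstart (\<gamma> {u, v}), pathfinish (\<gamma> {u, v})} = {p u, p v} \<and>
        path_image (\<gamma> {u, v}) \<inter> p ` pverts G = {p u, p v}) \<and>
    (\<forall>(u, v)\<in>parcs G. \<forall>(w, x)\<in>parcs G.
        {u, v} \<noteq> {w, x} \<longrightarrow>
        path_image (\<gamma> {u, v}) \<inter> path_image (\<gamma> {w, x}) = p ` ({u, v} \<inter> {w, x}))"

definition planar :: "'a pair_pre_digraph \<Rightarrow> bool" where
  "planar G \<longleftrightarrow> (\<exists>p \<gamma>. plane_drawing G p \<gamma>)"

text \<open>
  Every finite graph is isomorphic to one whose vertices are natural numbers. The set below is
  finite because only finitely many 0-1 matrices of size \<open>n\<close> occur.
\<close>

definition max_planar_spectral_radius :: "nat \<Rightarrow> real" where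
  "max_planar_spectral_radius n =
    Max {graph_spectral_radius G | G :: nat pair_pre_digraph.
           pair_graph G \<and> planar G \<and> card (pverts G) = n}"

end

theory Submission
  imports Defs "HOL-Analysis.Jordan_Curve" "HOL-Analysis.Smooth_Paths" "HOL-Analysis.Function_Topology"
begin

text \<open>
  Upper bound (Ellingham and Zha). For a vertex \<open>v\<close> of degree \<open>d\<close>, split the walks of length two from \<open>v\<close>
  by whether they end inside or outside the neighbourhood \<open>N\<close> of \<open>v\<close>. The graph induced on \<open>N \<union> {v}\<close> has at
  most \<open>3 (d + 1) - 6\<close> edges, and the bipartite graph between \<open>N\<close> and its complement at most \<open>2 n - 4\<close>, so
  the row of \<open>A\<^sup>2 - 4 A\<close> at \<open>v\<close> sums to at most \<open>2 n - 10\<close>. Pairing with a nonnegative eigenvector gives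
  \<open>\<rho>\<^sup>2 - 4 \<rho> \<le> 2 n - 10\<close>. In the case of equality the bound is attained on the whole support of the
  eigenvector, which is refuted by counting edges once more.

  The two edge bounds follow from Euler's formula, in the form of an inequality: faces are components
  of the complement of the drawing, an arc that closes a cycle adds at least one face by the Jordan
  curve theorem, and removing an arc never merges more than two faces by Janiszewski's theorem.

  Lower bound: the join of an edge and a path on \<open>n - 2\<close> vertices, with a test vector that is constant on
  the edge and on the path.
\<close>

section \<open>Arcs and components of the complement\<close>

text \<open>Janiszewski's theorem applies twice: first to \<open>K1\<close> and the arc, which meet
  at most in its start, then to their union and \<open>K2\<close>, which meet at most in the end of
  the arc. \<open>K1\<close> collects the pieces in the path component of the start,
  \<open>K2\<close> the others; finiteness of \<open>\<K>\<close> makes both compact.\<close>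

lemma connected_component_Un_arc_of_separated_ends:
  fixes g :: "real \<Rightarrow> complex"
  assumes fin: "finite \<K>" and comp: "\<And>K. K \<in> \<K> \<Longrightarrow> compact K"
    and conn: "\<And>K. K \<in> \<K> \<Longrightarrow> path_connected K"
    and "arc g" and gK: "path_image g \<inter> \<Union>\<K> \<subseteq> {pathstart g, pathfinish g}"
    and nab: "\<not> path_component (\<Union>\<K>) (pathstart g) (pathfinish g)"
    and xy: "connected_component (- \<Union>\<K>) x y"
    and "x \<notin> path_image g" "y \<notin> path_image g"
  shows "connected_component (- (\<Union>\<K> \<union> path_image g)) x y"
proof -
  define a b where "a = pathstart g" and "b = pathfinish g"
  define K1 where "K1 = \<Union>{K\<in>\<K>. K \<subseteq> path_component_set (\<Union>\<K>) a}"
  define K2 where "K2 = \<Union>{K\<in>\<K>. \<not> K \<subseteq> path_component_set (\<Union>\<K>) a}"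
  have un: "\<Union>\<K> = K1 \<union> K2"
    by (auto simp: K1_def K2_def)
  have in_comp: "K \<subseteq> path_component_set (\<Union>\<K>) a" if "z \<in> K" "K \<in> \<K>" "z \<in> path_component_set (\<Union>\<K>) a" for z K
  proof -
    have "K \<subseteq> path_component_set (\<Union>\<K>) z"
      using that conn by (intro path_component_maximal) auto
    then show ?thesis
      using that by (metis mem_Collect_eq path_component_eq)
  qed
  have disj: "K1 \<inter> K2 = {}"
    using in_comp by (auto simp: K1_def K2_def)
  have "a \<notin> K2"
  proof
    assume "a \<in> K2"
    then obtain K where K: "a \<in> K" "K \<in> \<K>" "\<not> K \<subseteq> path_component_set (\<Union>\<K>) a"
      by (auto simp: K2_def)
    then have "a \<in> path_component_set (\<Union>\<K>) a"
      by (auto intro: path_component_refl)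
    then show False using in_comp K by blast
  qed
  have "b \<notin> K1"
    using nab by (auto simp: K1_def a_def b_def)
  have compK: "compact K1" "compact K2"
    unfolding K1_def K2_def using fin comp by (auto intro!: compact_Union)
  have cg: "compact (path_image g)"
    using \<open>arc g\<close> by (simp add: compact_arc_image)
  have sub: "connected A" if "A \<subseteq> {z}" for A and z :: complex
    using that by (metis connected_empty connected_sing subset_singletonD)
  have cong: "connected_component (- path_image g) x y"
    using connected_arc_complement[OF \<open>arc g\<close>] assms(8,9)
    by (auto simp: connected_iff_connected_component)
  have "connected_component (- (K1 \<union> path_image g)) x y"
  proof (rule Janiszewski)
    show "connected (K1 \<inter> path_image g)"
      using gK \<open>b \<notin> K1\<close> un by (intro sub[of _ a]) (auto simp: a_def b_def)
    show "connected_component (- K1) x y"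
      using xy by (rule connected_component_of_subset) (auto simp: un)
  qed (use compK cg cong in \<open>auto simp: compact_imp_closed\<close>)
  then have "connected_component (- ((K1 \<union> path_image g) \<union> K2)) x y"
  proof (rule Janiszewski[rotated 3])
    have "(K1 \<union> path_image g) \<inter> K2 \<subseteq> {b}"
      using gK disj \<open>a \<notin> K2\<close> un by (auto simp: a_def b_def)
    then show "connected ((K1 \<union> path_image g) \<inter> K2)"
      by (rule sub)
    show "connected_component (- K2) x y"
      using xy by (rule connected_component_of_subset) (auto simp: un)
  qed (use compK cg in \<open>auto simp: compact_imp_closed compact_Un\<close>)
  then show ?thesis
    by (simp add: un Un_ac)
qed

text \<open>A path in \<open>K\<close> from the end of \<open>g\<close> back to its start contains
  an arc \<open>h\<close>, and \<open>g\<close> meets \<open>K\<close> only in its ends. The last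
  conclusion makes the loop meet \<open>K\<close> exactly in \<open>path_image h\<close>, a
  connected set, as Janiszewski's theorem requires.\<close>

lemma simple_closed_curve_through_arc:
  fixes g :: "real \<Rightarrow> complex"
  assumes "arc g" and gK: "path_image g \<inter> K \<subseteq> {pathstart g, pathfinish g}"
    and ab: "path_component K (pathstart g) (pathfinish g)"
  obtains h where "arc h" "path_image h \<subseteq> K" "simple_path (g +++ h)"
    "pathfinish (g +++ h) = pathstart (g +++ h)"
    "path_image (g +++ h) = path_image g \<union> path_image h"
    "path_image g \<inter> K \<subseteq> path_image h"
proof -
  have ne: "pathfinish g \<noteq> pathstart g"
    using \<open>arc g\<close> arc_distinct_ends by metis
  obtain h0 where h0: "path h0" "path_image h0 \<subseteq> K" "pathstart h0 = pathfinish g" "pathfinish h0 = pathstart g"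
    using path_component_sym[OF ab] by (auto simp: path_component_def)
  obtain h where h: "arc h" "path_image h \<subseteq> path_image h0" "pathstart h = pathfinish g" "pathfinish h = pathstart g"
    using path_contains_arc[OF h0(1,3,4) ne] .
  show ?thesis
  proof
    show "arc h" "path_image h \<subseteq> K" using h h0 by auto
    show "simple_path (g +++ h)"
      using h h0 gK \<open>arc g\<close> by (intro simple_path_join_loop) auto
    show "path_image (g +++ h) = path_image g \<union> path_image h"
      using h by (simp add: path_image_join)
    show "path_image g \<inter> K \<subseteq> path_image h"
      using gK h by (metis insert_subset pathfinish_in_path_image pathstart_in_path_image empty_subsetI order_trans)
  qed (use h in auto)
qed

text \<open>
  If the arc closes a cycle \<open>C\<close> through \<open>\<Union>\<K>\<close>, two of the three points lie on the same side of \<open>C\<close>, and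
  Janiszewski's theorem applies to \<open>\<Union>\<K>\<close> and \<open>C\<close>, whose intersection is the rest of \<open>C\<close>.
\<close>

lemma arc_merges_at_most_two:
  fixes g :: "real \<Rightarrow> complex"
  assumes fin: "finite \<K>" and comp: "\<And>K. K \<in> \<K> \<Longrightarrow> compact K"
    and conn: "\<And>K. K \<in> \<K> \<Longrightarrow> path_connected K"
    and "arc g" and gK: "path_image g \<inter> \<Union>\<K> \<subseteq> {pathstart g, pathfinish g}"
    and xy: "connected_component (- \<Union>\<K>) x y" and yz: "connected_component (- \<Union>\<K>) y z"
    and notin: "x \<notin> path_image g" "y \<notin> path_image g" "z \<notin> path_image g"
  shows "connected_component (- (\<Union>\<K> \<union> path_image g)) x y \<or>
    connected_component (- (\<Union>\<K> \<union> path_image g)) y z \<or>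
    connected_component (- (\<Union>\<K> \<union> path_image g)) x z"
proof (cases "path_component (\<Union>\<K>) (pathstart g) (pathfinish g)")
  case False
  then show ?thesis
    using connected_component_Un_arc_of_separated_ends assms by meson
next
  case True
  obtain h where h: "arc h" "path_image h \<subseteq> \<Union>\<K>" and c: "simple_path (g +++ h)"
    "pathfinish (g +++ h) = pathstart (g +++ h)"
    and im: "path_image (g +++ h) = path_image g \<union> path_image h"
    and gh: "path_image g \<inter> \<Union>\<K> \<subseteq> path_image h"
    using simple_closed_curve_through_arc[OF \<open>arc g\<close> gK True] .
  let ?C = "path_image (g +++ h)"
  note J = Jordan_inside_outside[OF c]
  have step: "connected_component (- (\<Union>\<K> \<union> path_image g)) u v"
    if uv: "connected_component (- \<Union>\<K>) u v" "connected_component (- ?C) u v" for u v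
  proof -
    have "connected_component (- (\<Union>\<K> \<union> ?C)) u v"
    proof (rule Janiszewski)
      have "\<Union>\<K> \<inter> ?C = path_image h"
        using im h gh by blast
      then show "connected (\<Union>\<K> \<inter> ?C)"
        using h by (simp add: connected_arc_image)
      show "closed ?C" using c by (simp add: closed_simple_path_image)
    qed (use uv comp fin in \<open>auto intro!: compact_Union\<close>)
    moreover have "\<Union>\<K> \<union> ?C = \<Union>\<K> \<union> path_image g"
      unfolding im using h(2) by auto
    ultimately show ?thesis by simp
  qed
  have notC: "x \<in> inside ?C \<union> outside ?C" "y \<in> inside ?C \<union> outside ?C" "z \<in> inside ?C \<union> outside ?C"
    using notin h(2) im J connected_component_in[OF xy] connected_component_in[OF yz] by auto
  have same: "connected_component (- ?C) u v"
    if "u \<in> inside ?C \<and> v \<in> inside ?C \<or> u \<in> outside ?C \<and> v \<in> outside ?C" for u v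
  proof -
    have "connected (inside ?C)" "connected (outside ?C)" using J by auto
    moreover have "inside ?C \<subseteq> - ?C" "outside ?C \<subseteq> - ?C"
      by (auto simp: inside_def outside_def)
    ultimately show ?thesis
      unfolding connected_component_def using that by metis
  qed
  have xz: "connected_component (- \<Union>\<K>) x z"
    using xy yz by (rule connected_component_trans)
  consider "connected_component (- ?C) x y" | "connected_component (- ?C) y z" | "connected_component (- ?C) x z"
    using notC same by (metis UnE)
  then show ?thesis
    using step xy yz xz by cases auto
qed

text \<open>The midpoint of \<open>g\<close> has a ball around it that avoids \<open>K\<close>. It
  is also on the frontier of both sides of the Jordan curve through \<open>g\<close>, so the ball
  contains a point \<open>x\<close> inside and a point \<open>y\<close> outside.\<close>

lemma arc_closing_cycle_separates:
  fixes g :: "real \<Rightarrow> complex"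
  assumes "closed K" "arc g" and gK: "path_image g \<inter> K \<subseteq> {pathstart g, pathfinish g}"
    and ab: "path_component K (pathstart g) (pathfinish g)"
  obtains x y where "x \<notin> K \<union> path_image g" "y \<notin> K \<union> path_image g"
    "connected_component (- K) x y" "\<not> connected_component (- (K \<union> path_image g)) x y"
proof -
  obtain h where h: "arc h" "path_image h \<subseteq> K" and c: "simple_path (g +++ h)"
    "pathfinish (g +++ h) = pathstart (g +++ h)"
    and im: "path_image (g +++ h) = path_image g \<union> path_image h"
    using simple_closed_curve_through_arc[OF assms(2-4)] by metis
  let ?C = "path_image (g +++ h)"
  note J = Jordan_inside_outside[OF c]
  have inj: "inj_on g {0..1}" using \<open>arc g\<close> by (simp add: arc_def)
  have "g (1/2) \<noteq> g 0" "g (1/2) \<noteq> g 1"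
    using inj_onD[OF inj, of "1/2" 0] inj_onD[OF inj, of "1/2" 1] by auto
  moreover have mem: "g (1/2) \<in> path_image g" by (auto simp: path_image_def)
  ultimately have "g (1/2) \<in> - K"
    using gK by (auto simp: pathstart_def pathfinish_def)
  then obtain e where e: "e > 0" "ball (g (1/2)) e \<subseteq> - K"
    using \<open>closed K\<close> by (meson open_Compl open_contains_ball)
  let ?B = "ball (g (1/2)) e"
  have fr: "g (1/2) \<in> frontier (inside ?C)" "g (1/2) \<in> frontier (outside ?C)"
    using mem im J by auto
  have B: "open ?B" "g (1/2) \<in> ?B" using e by auto
  obtain x where x: "x \<in> inside ?C" "x \<in> ?B"
    using fr(1) B unfolding frontier_straddle by (metis dist_commute mem_ball e(1))
  obtain y where y: "y \<in> outside ?C" "y \<in> ?B"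
    using fr(2) B unfolding frontier_straddle by (metis dist_commute mem_ball e(1))
  show ?thesis
  proof
    have disj: "inside ?C \<inter> ?C = {}" "outside ?C \<inter> ?C = {}" "inside ?C \<inter> outside ?C = {}"
      using J by blast+
    show "x \<notin> K \<union> path_image g" "y \<notin> K \<union> path_image g"
      using x y e im disj by blast+
    show "connected_component (- K) x y"
      unfolding connected_component_def using x y e by (intro exI[of _ ?B]) auto
    show "\<not> connected_component (- (K \<union> path_image g)) x y"
    proof
      assume "connected_component (- (K \<union> path_image g)) x y"
      then have "connected_component (- ?C) x y"
        by (rule connected_component_of_subset) (use im h in auto)
      then have "y \<in> inside ?C"
        using inside_same_component x by blast
      then show False using y disj by blast
    qed
  qed
qed

text \<open>Invariance of dimension: the inverse of the arc would embed a nonempty open set of the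
  plane in the line.\<close>

lemma interior_arc_image:
  fixes g :: "real \<Rightarrow> complex"
  assumes "arc g"
  shows "interior (path_image g) = {}"
proof (rule ccontr)
  assume ne: "interior (path_image g) \<noteq> {}"
  obtain h where h: "homeomorphism {0..1} (path_image g) g h"
    using homeomorphism_arc[OF assms] .
  have "DIM(complex) \<le> DIM(real)"
  proof (rule invariance_of_dimension[OF _ _ _ ne])
    show "continuous_on (interior (path_image g)) h"
      using h interior_subset by (metis continuous_on_subset homeomorphism_def)
    show "inj_on h (interior (path_image g))"
      using h interior_subset by (metis homeomorphism_apply2 inj_on_inverseI inj_on_subset)
  qed auto
  then show False by simp
qed

section \<open>Plane drawings and Euler's formula\<close>

lemma card_le_2_if_no_three:
  assumes "\<And>x y z. \<lbrakk>x \<in> A; y \<in> A; z \<in> A\<rbrakk> \<Longrightarrow> x = y \<or> y = z \<or> x = z"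
  shows "finite A \<and> card A \<le> 2"
proof (rule ccontr)
  assume *: "\<not> ?thesis"
  have "\<exists>B \<subseteq> A. card B = 3 \<and> finite B"
  proof (cases "finite A")
    case True
    then show ?thesis
      using * obtain_subset_with_card_n[of 3 A] by (metis not_less_eq_eq numeral_2_eq_2 numeral_3_eq_3 )
  next
    case False
    then show ?thesis
      using infinite_arbitrarily_large[of A 3] by auto
  qed
  then obtain B x y z where "B \<subseteq> A" "B = {x, y, z}" "x \<noteq> y" "y \<noteq> z" "x \<noteq> z"
    by (auto simp: card_3_iff)
  then show False using assms[of x y z] by auto
qed

text \<open>Vertex and edge set are parameters, so that the bounds can be used for any subgraph of
  one fixed drawing.\<close>

locale plane_arc_graph =
  fixes V :: "'a set" and E :: "'a set set" and p :: "'a \<Rightarrow> complex" and \<gamma> :: "'a set \<Rightarrow> real \<Rightarrow> complex"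
  assumes finite_V: "finite V"
    and edge: "e \<in> E \<Longrightarrow> \<exists>u v. u \<in> V \<and> v \<in> V \<and> u \<noteq> v \<and> e = {u, v}"
    and inj: "inj_on p V"
    and arc: "e \<in> E \<Longrightarrow> arc (\<gamma> e)"
    and ends: "e \<in> E \<Longrightarrow> {pathstart (\<gamma> e), pathfinish (\<gamma> e)} = p ` e"
    and meet: "\<lbrakk>e \<in> E; e' \<in> E; e \<noteq> e'\<rbrakk> \<Longrightarrow> path_image (\<gamma> e) \<inter> path_image (\<gamma> e') = p ` (e \<inter> e')"
begin

text \<open>Only edges are drawn; a vertex on no edge of \<open>S\<close> contributes no
  point.\<close>

definition drawing :: "'a set set \<Rightarrow> complex set" where
  "drawing S = (\<Union>e\<in>S. path_image (\<gamma> e))"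

definition faces :: "'a set set \<Rightarrow> complex set set" where
  "faces S = components (- drawing S)"

lemma finite_E: "finite E"
proof -
  have "E \<subseteq> Pow V" using edge by blast
  then show ?thesis using finite_V by (metis finite_Pow_iff finite_subset)
qed

lemma finite_edges: "S \<subseteq> E \<Longrightarrow> finite S"
  using finite_E finite_subset by blast

lemma compact_drawing: "S \<subseteq> E \<Longrightarrow> compact (drawing S)"
  unfolding drawing_def using finite_edges arc by (intro compact_UN) (auto intro: compact_arc_image)

lemma closed_drawing: "S \<subseteq> E \<Longrightarrow> closed (drawing S)"
  using compact_drawing compact_imp_closed by blast

lemma drawing_insert: "drawing (insert e S) = drawing S \<union> path_image (\<gamma> e)"
  by (auto simp: drawing_def)

lemma drawing_mono: "S \<subseteq> T \<Longrightarrow> drawing S \<subseteq> drawing T"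
  by (auto simp: drawing_def)

lemma meet_drawing:
  assumes "S \<subseteq> E" "e \<in> E" "e \<notin> S"
  shows "path_image (\<gamma> e) \<inter> drawing S \<subseteq> p ` (e \<inter> \<Union>S)"
proof
  fix z assume z: "z \<in> path_image (\<gamma> e) \<inter> drawing S"
  then obtain e' where "e' \<in> S" "z \<in> path_image (\<gamma> e')"
    by (auto simp: drawing_def)
  then show "z \<in> p ` (e \<inter> \<Union>S)"
    using z meet[of e e'] assms by blast
qed

lemma open_face: "\<lbrakk>S \<subseteq> E; F \<in> faces S\<rbrakk> \<Longrightarrow> open F"
  unfolding faces_def using closed_drawing open_components by blast

lemma face_not_subset_arc:
  assumes "S \<subseteq> E" "F \<in> faces S" "e \<in> E"
  shows "\<not> F \<subseteq> path_image (\<gamma> e)"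
proof
  assume "F \<subseteq> path_image (\<gamma> e)"
  then have "F \<subseteq> interior (path_image (\<gamma> e))"
    using open_face[OF assms(1,2)] by (rule interior_maximal)
  then show False
    using interior_arc_image[OF arc[OF \<open>e \<in> E\<close>]] in_components_nonempty assms(2) by (auto simp: faces_def)
qed

text \<open>The part of the arc off \<open>drawing S\<close> is connected, so it lies in one old
  face. An old face that misses the arc stays a face, so every new face is cut out of that one. By
  \<open>arc_merges_at_most_two\<close>, of any three points there off the arc, two stay
  connected.\<close>

lemma new_faces:
  assumes S: "S \<subseteq> E" and e: "e \<in> E" "e \<notin> S"
  shows "finite (faces (insert e S) - faces S) \<and> card (faces (insert e S) - faces S) \<le> 2"
proof (rule card_le_2_if_no_three)
  let ?g = "\<gamma> e" and ?K = "drawing S"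
  have meets: "path_image ?g \<inter> ?K \<subseteq> {pathstart ?g, pathfinish ?g}"
    using meet_drawing[OF S e] ends[OF e(1)] by blast
  have arcg: "arc ?g" using arc e by blast
  \<comment> \<open>The set lies between the open arc and its closure, whether or not the ends are
    on \<open>drawing S\<close>.\<close>
  have conn: "connected (path_image ?g - ?K)"
  proof (rule connected_intermediate_closure)
    show "connected (?g ` {0<..<1})"
      using arcg by (intro connected_continuous_image)
        (auto simp: arc_def path_def elim: continuous_on_subset)
    have inj: "inj_on ?g {0..1}" using arcg by (simp add: arc_def)
    have ne: "?g t \<noteq> ?g 0" "?g t \<noteq> ?g 1" if "t \<in> {0<..<1}" for t
      using that inj_onD[OF inj, of t 0] inj_onD[OF inj, of t 1] by auto
    show "?g ` {0<..<1} \<subseteq> path_image ?g - ?K"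
    proof
      fix y assume "y \<in> ?g ` {0<..<1}"
      then obtain t where t: "t \<in> {0<..<1}" "y = ?g t" by blast
      then have "y \<in> path_image ?g" by (auto simp: path_image_def)
      moreover have "y \<notin> {pathstart ?g, pathfinish ?g}"
        using ne t by (simp add: pathstart_def pathfinish_def)
      ultimately show "y \<in> path_image ?g - ?K" using meets by blast
    qed
    have "?g ` closure {0<..<1} \<subseteq> closure (?g ` {0<..<1})"
      using arcg by (intro image_closure_subset) (auto simp: arc_def path_def intro: closure_subset[THEN subsetD])
    then show "path_image ?g - ?K \<subseteq> closure (?g ` {0<..<1})"
      by (auto simp: path_image_def)
  qed
  fix F1 F2 F3
  assume F: "F1 \<in> faces (insert e S) - faces S" "F2 \<in> faces (insert e S) - faces S" "F3 \<in> faces (insert e S) - faces S"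
  have witness: "\<exists>x. F = connected_component_set (- (?K \<union> path_image ?g)) x \<and>
      x \<notin> path_image ?g \<and> (\<forall>z \<in> path_image ?g - ?K. connected_component (- ?K) x z) \<and> path_image ?g - ?K \<noteq> {}"
    if F: "F \<in> faces (insert e S) - faces S" for F
  proof -
    obtain x where x: "x \<notin> ?K" "x \<notin> path_image ?g" and Fx: "F = connected_component_set (- (?K \<union> path_image ?g)) x"
      using F by (auto simp: faces_def drawing_insert components_def)
    let ?D = "connected_component_set (- ?K) x"
    have D: "?D \<in> faces S" using x by (auto simp: faces_def components_def)
    have "F \<subseteq> ?D" unfolding Fx by (intro connected_component_mono) auto
    have "?D \<inter> path_image ?g \<noteq> {}"
    proof
      assume "?D \<inter> path_image ?g = {}"
      then have "?D \<subseteq> F"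
        unfolding Fx using x connected_component_subset[of "- ?K" x]
        by (intro connected_component_maximal) auto
      then show False using \<open>F \<subseteq> ?D\<close> D F by auto
    qed
    then obtain z where z: "z \<in> ?D" "z \<in> path_image ?g" by auto
    then have "z \<notin> ?K" using connected_component_in by fastforce
    have "path_image ?g - ?K \<subseteq> connected_component_set (- ?K) z"
      using z \<open>z \<notin> ?K\<close> conn by (intro connected_component_maximal) auto
    then have "\<forall>w \<in> path_image ?g - ?K. connected_component (- ?K) x w"
      using z connected_component_trans by fastforce
    then show ?thesis
      using Fx x z \<open>z \<notin> ?K\<close> by blast
  qed
  obtain x1 where 1: "F1 = connected_component_set (- (?K \<union> path_image ?g)) x1"
      "x1 \<notin> path_image ?g" "\<forall>z \<in> path_image ?g - ?K. connected_component (- ?K) x1 z" "path_image ?g - ?K \<noteq> {}"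
    using witness[OF F(1)] by blast
  obtain x2 where 2: "F2 = connected_component_set (- (?K \<union> path_image ?g)) x2"
      "x2 \<notin> path_image ?g" "\<forall>z \<in> path_image ?g - ?K. connected_component (- ?K) x2 z"
    using witness[OF F(2)] by blast
  obtain x3 where 3: "F3 = connected_component_set (- (?K \<union> path_image ?g)) x3"
      "x3 \<notin> path_image ?g" "\<forall>z \<in> path_image ?g - ?K. connected_component (- ?K) x3 z"
    using witness[OF F(3)] by blast
  obtain z where z: "z \<in> path_image ?g - ?K" using 1 by blast
  have K: "?K = \<Union>((\<lambda>e. path_image (\<gamma> e)) ` S)" by (simp add: drawing_def)
  have "connected_component (- (?K \<union> path_image ?g)) x1 x2 \<or>
      connected_component (- (?K \<union> path_image ?g)) x2 x3 \<or>
      connected_component (- (?K \<union> path_image ?g)) x1 x3"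
    unfolding K
  proof (rule arc_merges_at_most_two)
    show "finite ((\<lambda>e. path_image (\<gamma> e)) ` S)" using S finite_edges by auto
    show "connected_component (- \<Union>((\<lambda>e. path_image (\<gamma> e)) ` S)) x1 x2" "connected_component (- \<Union>((\<lambda>e. path_image (\<gamma> e)) ` S)) x2 x3"
      using 1(3) 2(3) 3(3) z K by (metis connected_component_sym connected_component_trans)+
    show "path_image ?g \<inter> \<Union>((\<lambda>e. path_image (\<gamma> e)) ` S) \<subseteq> {pathstart ?g, pathfinish ?g}"
      using meets unfolding K .
    fix L assume "L \<in> (\<lambda>e. path_image (\<gamma> e)) ` S"
    then obtain e' where "e' \<in> S" "L = path_image (\<gamma> e')" by blast
    then show "compact L" "path_connected L"
      using arc[of e'] S by (auto intro: compact_arc_image path_connected_path_image arc_imp_path)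
  qed (use 1(2) 2(2) 3(2) arcg in auto)
  then show "F1 = F2 \<or> F2 = F3 \<or> F1 = F3"
    unfolding 1 2 3 using connected_component_eq by (metis mem_Collect_eq)
qed

lemma finite_faces:
  assumes "S \<subseteq> E" shows "finite (faces S)"
  using finite_edges[OF assms] assms
proof (induction S)
  case empty
  have "faces {} \<subseteq> {UNIV}"
    by (auto simp: faces_def drawing_def)
  then show ?case using finite_subset by blast
next
  case (insert e S)
  have "faces (insert e S) \<subseteq> faces S \<union> (faces (insert e S) - faces S)" by blast
  then show ?case
    using insert new_faces[of S e] by (meson finite_Un finite_subset insert_subset)
qed

text \<open>The map \<open>c\<close> sends a face of the larger drawing to the old face around it.
  It is onto because no old face is contained in an arc. If the arc closes a cycle, \<open>c\<close>
  is not injective, since two points of one old face get separated.\<close>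

lemma faces_insert:
  assumes S: "S \<subseteq> E" and e: "e \<in> E" "e \<notin> S"
  shows "card (faces S) \<le> card (faces (insert e S))"
    and "path_component (drawing S) (pathstart (\<gamma> e)) (pathfinish (\<gamma> e)) \<Longrightarrow>
      card (faces S) < card (faces (insert e S))"
proof -
  let ?X = "drawing (insert e S)"
  define c where "c F = connected_component_set (- drawing S) (SOME x. x \<in> F)" for F
  have c: "c (connected_component_set (- ?X) x) = connected_component_set (- drawing S) x"
    if "x \<notin> ?X" for x
  proof -
    have "(SOME y. connected_component (- ?X) x y) \<in> connected_component_set (- ?X) x"
      using that by (metis ComplI connected_component_refl mem_Collect_eq someI_ex)
    then have "(SOME y. connected_component (- ?X) x y) \<in> connected_component_set (- drawing S) x"
      by (auto simp: drawing_insert intro: connected_component_of_subset)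
    then show ?thesis
      unfolding c_def using connected_component_eq by fastforce
  qed
  have "faces S \<subseteq> c ` faces (insert e S)"
  proof
    fix D assume D: "D \<in> faces S"
    then obtain x where x: "x \<in> D" "x \<notin> path_image (\<gamma> e)"
      using face_not_subset_arc S e by blast
    obtain w where "D = connected_component_set (- drawing S) w"
      using D by (auto simp: faces_def components_def)
    then have Dx: "D = connected_component_set (- drawing S) x"
      using x connected_component_eq by metis
    have "x \<notin> drawing S"
      using x(1) D in_components_subset unfolding faces_def by blast
    then have nx: "x \<notin> ?X" using x(2) by (simp add: drawing_insert)
    then have "connected_component_set (- ?X) x \<in> faces (insert e S)"
      by (auto simp: faces_def components_def)
    then show "D \<in> c ` faces (insert e S)"
      using c[OF nx] Dx by blast
  qed
  moreover have fin: "finite (faces (insert e S))"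
    using finite_faces S e by auto
  ultimately show le: "card (faces S) \<le> card (faces (insert e S))"
    by (meson card_image_le card_mono finite_imageI order_trans)
  show "card (faces S) < card (faces (insert e S))"
    if pc: "path_component (drawing S) (pathstart (\<gamma> e)) (pathfinish (\<gamma> e))"
  proof -
    have "path_image (\<gamma> e) \<inter> drawing S \<subseteq> {pathstart (\<gamma> e), pathfinish (\<gamma> e)}"
      using meet_drawing[OF S e] ends[OF e(1)] by blast
    then obtain x y where xy: "x \<notin> ?X" "y \<notin> ?X" "connected_component (- drawing S) x y"
        "\<not> connected_component (- ?X) x y"
      using arc_closing_cycle_separates[OF closed_drawing[OF S] arc[OF e(1)] _ pc]
      by (metis drawing_insert)
    let ?c = "connected_component_set (- ?X)"
    have "?c x \<noteq> ?c y" using xy by (metis ComplI connected_component_refl mem_Collect_eq)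
    moreover have "c (?c x) = c (?c y)"
      using c xy connected_component_eq by (metis mem_Collect_eq)
    moreover have "?c x \<in> faces (insert e S)" "?c y \<in> faces (insert e S)"
      using xy by (auto simp: faces_def components_def)
    ultimately have "\<not> inj_on c (faces (insert e S))"
      by (auto simp: inj_on_def)
    then have "card (c ` faces (insert e S)) < card (faces (insert e S))"
      using fin by (meson card_image_le inj_on_iff_eq_card le_neq_implies_less)
    then show ?thesis
      using \<open>faces S \<subseteq> _\<close> fin by (meson card_mono finite_imageI le_less_trans)
  qed
qed

text \<open>Induction over the edges, with the number of classes in the count. An edge inside a
  class closes a cycle and gains a face; an edge between two classes merges them and loses no face.
  The clause \<open>u \<noteq> v\<close> is there because an isolated vertex is not on the drawing
  and so has no path to itself in it.\<close>

lemma Euler_ge: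
  assumes "S \<subseteq> E" "V \<noteq> {}"
  shows "card S + 2 \<le> card (faces S) + card V"
proof -
  \<comment> \<open>the classes of \<open>l\<close> are the connected components of the graph\<close>
  have "\<exists>l :: 'a \<Rightarrow> 'a. (\<forall>u\<in>V. \<forall>v\<in>V. l u = l v \<longrightarrow> u \<noteq> v \<longrightarrow> path_component (drawing S) (p u) (p v)) \<and>
      card S + 1 + card (l ` V) \<le> card (faces S) + card V"
    using finite_edges[OF assms(1)] assms(1)
  proof (induction S)
    case empty
    have "faces {} = {UNIV}"
      by (auto simp: faces_def drawing_def components_def)
    then show ?case by (intro exI[of _ id]) auto
  next
    case (insert e S)
    then have "\<exists>l :: 'a \<Rightarrow> 'a. (\<forall>u\<in>V. \<forall>v\<in>V. l u = l v \<longrightarrow> u \<noteq> v \<longrightarrow> path_component (drawing S) (p u) (p v)) \<and>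
      card S + 1 + card (l ` V) \<le> card (faces S) + card V" by blast
    then obtain l :: "'a \<Rightarrow> 'a" where l: "\<And>u v. \<lbrakk>u \<in> V; v \<in> V; l u = l v; u \<noteq> v\<rbrakk> \<Longrightarrow> path_component (drawing S) (p u) (p v)"
      and card: "card S + 1 + card (l ` V) \<le> card (faces S) + card V" by blast
    have eS: "S \<subseteq> E" "e \<in> E" "e \<notin> S" "finite S" using insert by auto
    let ?P = "path_component (drawing (insert e S))"
    have mono: "?P x y" if "path_component (drawing S) x y" for x y
      using that by (rule path_component_of_subset[rotated]) (simp add: drawing_mono subset_insertI)
    obtain u v where uv: "u \<in> V" "v \<in> V" "u \<noteq> v" "e = {u, v}" using edge[OF eS(2)] by blast
    have ends': "pathstart (\<gamma> e) = p u \<and> pathfinish (\<gamma> e) = p v \<or> pathstart (\<gamma> e) = p v \<and> pathfinish (\<gamma> e) = p u"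
      using ends[OF eS(2)] uv by (auto simp: doubleton_eq_iff)
    show ?case
    proof (cases "l u = l v")
      case True
      then have "path_component (drawing S) (pathstart (\<gamma> e)) (pathfinish (\<gamma> e))"
        using l[of u v] l[of v u] uv ends' by auto
      then have "card (faces S) < card (faces (insert e S))"
        using faces_insert(2)[OF eS(1-3)] by simp
      then show ?thesis
        using card eS(3,4) l mono by (intro exI[of _ l]) simp
    next
      case False
      \<comment> \<open>The class of \<open>v\<close> joins that of \<open>u\<close>, so exactly the
        label \<open>l v\<close> disappears.\<close>
      define l' where "l' x = (if l x = l v then l u else l x)" for x
      have "path_component (path_image (\<gamma> e)) (pathstart (\<gamma> e)) (pathfinish (\<gamma> e))"
        unfolding path_component_def using arc[OF eS(2)] by (auto intro: arc_imp_path)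
      then have "?P (pathstart (\<gamma> e)) (pathfinish (\<gamma> e))"
        by (rule path_component_of_subset[rotated]) (auto simp: drawing_insert)
      then have Puv: "?P (p u) (p v)" "?P (p v) (p u)"
        using ends' path_component_sym by metis+
      have refl: "?P (p u) (p u)" "?P (p v) (p v)"
        using Puv path_component_mem path_component_refl by metis+
      have lu: "?P (p u) (p x)" if "x \<in> V" "l x = l u \<or> l x = l v" for x
        using that l[of u x] l[of v x] mono Puv refl uv path_component_trans by metis
      have "?P (p x) (p y)" if xy: "x \<in> V" "y \<in> V" "l' x = l' y" "x \<noteq> y" for x y
      proof (cases "l x = l y")
        case True then show ?thesis using l mono xy by blast
      next
        case False
        then have "l x = l u \<or> l x = l v" "l y = l u \<or> l y = l v"
          using xy by (auto simp: l'_def split: if_splits)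
        then show ?thesis using lu xy path_component_sym path_component_trans by metis
      qed
      moreover have "card (l' ` V) + 1 = card (l ` V)"
      proof -
        have "l' ` V = l ` V - {l v}"
          using False uv by (auto simp: l'_def image_iff)
        moreover have "l v \<in> l ` V" "finite (l ` V)" using uv finite_V by auto
        ultimately show ?thesis by (metis card.remove Suc_eq_plus1)
      qed
      moreover have "card (faces S) \<le> card (faces (insert e S))"
        using faces_insert(1)[OF eS(1-3)] by simp
      ultimately show ?thesis
        using card eS(3,4) by (intro exI[of _ l']) simp
    qed
  qed
  then obtain l :: "'a \<Rightarrow> 'a" where "card S + 1 + card (l ` V) \<le> card (faces S) + card V" by auto
  moreover have "card (l ` V) > 0" using assms finite_V by (simp add: card_gt_0_iff)
  ultimately show ?thesis by linarith
qed

section \<open>Edges bordering a face, and edge bounds from the girth\<close>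

text \<open>\<open>F \<notin> faces (S - {e})\<close> expresses that \<open>e\<close> borders
  \<open>F\<close>. If the face \<open>D\<close> of the bordering edges around \<open>F\<close> were
  larger, it would contain a frontier point of \<open>F\<close> that is no vertex. That point is on
  an edge \<open>a\<close> not bordering \<open>F\<close>; but then the frontier of \<open>F\<close>
  is covered by the edges other than \<open>a\<close>, which meet \<open>a\<close> only in
  vertices.\<close>

lemma face_of_bordering_edges:
  assumes S: "S \<subseteq> E" and F: "F \<in> faces S"
  shows "F \<in> faces {e \<in> S. F \<notin> faces (S - {e})}"
proof -
  let ?T = "{e \<in> S. F \<notin> faces (S - {e})}"
  have T: "?T \<subseteq> S" by auto
  have F': "connected F" "F \<subseteq> - drawing S" "F \<noteq> {}" "open F"
    using F open_face[OF S F] in_components_connected in_components_subset in_components_nonempty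
    unfolding faces_def by blast+
  obtain x where x: "x \<in> F" using F' by blast
  then have "x \<notin> drawing S" using F' by auto
  define D where "D = connected_component_set (- drawing ?T) x"
  have xT: "x \<notin> drawing ?T" using \<open>x \<notin> drawing S\<close> drawing_mono[OF T] by auto
  then have DT: "D \<in> faces ?T" by (auto simp: D_def faces_def components_def)
  have FD: "F \<subseteq> D" unfolding D_def using F' x drawing_mono[OF T] by (intro connected_component_maximal) auto
  have openD: "open D" "connected D"
    using open_face[OF _ DT] T S by (auto simp: D_def)
  have "D \<subseteq> F"
  proof (rule ccontr)
    assume "\<not> D \<subseteq> F"
    have frX: "frontier F \<subseteq> drawing S"
      using F closed_drawing[OF S] frontier_of_components_closed_complement unfolding faces_def by blast
    let ?W = "p ` V"
    have "D \<inter> frontier F \<noteq> {}"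
      using \<open>\<not> D \<subseteq> F\<close> x FD openD by (intro connected_Int_frontier) auto
    then obtain z where z: "z \<in> D" "z \<in> drawing S" using frX by auto
    then obtain e where e: "e \<in> S" "z \<in> path_image (\<gamma> e)" by (auto simp: drawing_def)
    \<comment> \<open>An arc has no isolated points, so the open set \<open>D\<close> contains a
      point of \<open>e\<close> that is no vertex. It shows that \<open>D - ?W\<close> is not
      contained in \<open>F\<close>.\<close>
    have "infinite (D \<inter> path_image (\<gamma> e))"
    proof -
      have ar: "arc (\<gamma> e)" using e S arc by blast
      have "z islimpt path_image (\<gamma> e)"
      proof (rule connected_imp_perfect)
        show "connected (path_image (\<gamma> e))" using ar by (simp add: connected_arc_image)
        show "\<And>a. path_image (\<gamma> e) \<noteq> {a}"
          using ar arc_distinct_ends pathstart_in_path_image pathfinish_in_path_image by (metis singletonD)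
      qed (rule e(2))
      then show ?thesis
        using z openD(1) unfolding islimpt_eq_acc_point by (metis Int_commute)
    qed
    moreover have "finite ?W" using finite_V by auto
    ultimately obtain y where y: "y \<in> D" "y \<in> path_image (\<gamma> e)" "y \<notin> ?W"
      by (meson IntE finite_subset subsetI)
    have "infinite F" using F'(3,4) by (metis finite_imp_not_open)
    then obtain x' where x': "x' \<in> F" "x' \<notin> ?W"
      using \<open>finite ?W\<close> by (meson finite_subset subsetI)
    \<comment> \<open>A connected open set stays connected without finitely many points, so the
      frontier point can be chosen off the vertices.\<close>
    have "(D - ?W) \<inter> frontier F \<noteq> {}"
    proof (rule connected_Int_frontier)
      show "connected (D - ?W)"
        using openD \<open>finite ?W\<close> by (intro connected_open_delete_finite) auto
      show "(D - ?W) \<inter> F \<noteq> {}" using x' FD by auto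
      have "y \<notin> F" using y e F' by (auto simp: drawing_def)
      then show "D - ?W - F \<noteq> {}" using y by auto
    qed
    then obtain w where w: "w \<in> D" "w \<notin> ?W" "w \<in> frontier F" by auto
    then obtain a where a: "a \<in> S" "w \<in> path_image (\<gamma> a)" using frX by (auto simp: drawing_def)
    have "w \<notin> drawing ?T" using w(1) connected_component_in unfolding D_def by fastforce
    then have "a \<notin> ?T" using a by (auto simp: drawing_def)
    then have Fa: "F \<in> faces (S - {a})" using a by auto
    have Sa: "S - {a} \<subseteq> E" "a \<in> E" "a \<notin> S - {a}" using S a by auto
    have "a \<inter> \<Union>(S - {a}) \<subseteq> V" using edge Sa by blast
    then have "w \<notin> drawing (S - {a})"
      using meet_drawing[OF Sa] a w by blast
    moreover have "frontier F \<subseteq> drawing (S - {a})"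
      using Fa closed_drawing[OF Sa(1)] frontier_of_components_closed_complement unfolding faces_def by blast
    ultimately show False using w by auto
  qed
  then show ?thesis using FD DT by auto
qed

text \<open>The last hypothesis says that every nonempty subgraph has a leaf, that is,
  \<open>T\<close> is a forest. A leaf edge meets the rest in at most one point, so by Janiszewski's
  theorem putting it back keeps the complement connected.\<close>

lemma connected_complement_if_peelable:
  assumes "finite T" "T \<subseteq> E"
    and "\<And>T'. T' \<subseteq> T \<Longrightarrow> T' \<noteq> {} \<Longrightarrow> \<exists>e\<in>T'. \<exists>x\<in>e. x \<notin> \<Union>(T' - {e})"
  shows "connected (- drawing T)"
  using assms
proof (induction "card T" arbitrary: T)
  case 0
  then show ?case by (simp add: drawing_def connected_UNIV)
next
  case (Suc n)
  then have "T \<noteq> {}" by auto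
  then obtain e x where e: "e \<in> T" "x \<in> e" "x \<notin> \<Union>(T - {e})"
    using Suc.prems(3)[of T] by blast
  let ?T = "T - {e}"
  have "card ?T = n" using Suc e by simp
  moreover have "\<And>T'. T' \<subseteq> ?T \<Longrightarrow> T' \<noteq> {} \<Longrightarrow> \<exists>e\<in>T'. \<exists>x\<in>e. x \<notin> \<Union>(T' - {e})"
    using Suc.prems(3) by (meson Diff_subset order_trans)
  ultimately have IH: "connected (- drawing ?T)"
    using Suc by (metis Diff_subset finite_Diff order_trans)
  have sub: "?T \<subseteq> E" "e \<in> E" "e \<notin> ?T" using Suc.prems e by auto
  obtain y where y: "e = {x, y}" using edge[OF sub(2)] e by blast
  have *: "path_image (\<gamma> e) \<inter> drawing ?T \<subseteq> {p y}"
    using meet_drawing[OF sub] e y by blast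
  have "connected (- (drawing ?T \<union> path_image (\<gamma> e)))"
  proof (rule Janiszewski_connected[OF compact_drawing[OF sub(1)] _ _ IH])
    show "connected (- path_image (\<gamma> e))" "closed (path_image (\<gamma> e))"
      using arc[OF sub(2)] by (simp_all add: connected_arc_complement closed_arc_image)
    have "drawing ?T \<inter> path_image (\<gamma> e) = {} \<or> drawing ?T \<inter> path_image (\<gamma> e) = {p y}"
      using * by blast
    then show "connected (drawing ?T \<inter> path_image (\<gamma> e))"
      by (metis connected_empty connected_sing)
  qed
  then show ?case
    using e by (simp add: drawing_insert[symmetric] insert_absorb)
qed

text \<open>Incidences of faces and bordering edges are counted in two ways. Fewer than
  \<open>g\<close> bordering edges would form a forest, whose complement is connected, so their face
  would be the only one. Each edge borders at most two faces by \<open>new_faces\<close>.\<close>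

lemma girth_bound:
  assumes girth: "\<And>T. \<lbrakk>T \<subseteq> E; T \<noteq> {}; card T < g\<rbrakk> \<Longrightarrow> \<exists>e\<in>T. \<exists>x\<in>e. x \<notin> \<Union>(T - {e})"
    and two: "card (faces E) \<ge> 2"
  shows "g * card (faces E) \<le> 2 * card E"
proof -
  let ?R = "\<lambda>F e. F \<notin> faces (E - {e})"
  have "g \<le> card {e \<in> E. ?R F e}" if F: "F \<in> faces E" for F
  proof (rule ccontr)
    let ?T = "{e \<in> E. ?R F e}"
    assume "\<not> g \<le> card ?T"
    have fin: "finite ?T" using finite_E by auto
    have "connected (- drawing ?T)"
    proof (rule connected_complement_if_peelable)
      fix T' assume T': "T' \<subseteq> ?T" "T' \<noteq> {}"
      then have "card T' < g" using \<open>\<not> g \<le> card ?T\<close> fin card_mono by (meson le_trans not_le_imp_less)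
      then show "\<exists>e\<in>T'. \<exists>x\<in>e. x \<notin> \<Union>(T' - {e})"
        using girth T' by (metis (no_types, lifting) mem_Collect_eq subset_iff)
    qed (use fin in auto)
    moreover have "F \<in> faces ?T" using face_of_bordering_edges[OF _ F] by auto
    ultimately have "F = - drawing ?T"
      unfolding faces_def in_components_maximal by blast
    have "F' = F" if F': "F' \<in> faces E" for F'
    proof -
      have "F' \<noteq> {}" "F' \<subseteq> - drawing E"
        using F' in_components_subset in_components_nonempty by (auto simp: faces_def)
      then have "F' \<inter> F \<noteq> {}"
        using drawing_mono[of ?T E] \<open>F = - drawing ?T\<close> by blast
      then show ?thesis
        using components_eq F F' unfolding faces_def by blast
    qed
    then have "faces E \<subseteq> {F}" by auto
    then have "card (faces E) \<le> card {F}" by (intro card_mono) auto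
    then show False using two by simp
  qed
  then have "g * card (faces E) \<le> (\<Sum>F\<in>faces E. card {e \<in> E. ?R F e})"
    using sum_mono[of "faces E" "\<lambda>_. g"] by (simp add: mult.commute)
  also have "\<dots> = (\<Sum>e\<in>E. card {F \<in> faces E. ?R F e})"
    using sum_multicount_gen[of "faces E" E "\<lambda>F e. ?R F e"] finite_faces[of E] finite_E by auto
  also have "\<dots> \<le> (\<Sum>e\<in>E. 2)"
  proof (rule sum_mono)
    fix e assume e: "e \<in> E"
    have "{F \<in> faces E. ?R F e} = faces (insert e (E - {e})) - faces (E - {e})"
      using e by (auto simp: insert_absorb)
    then show "card {F \<in> faces E. ?R F e} \<le> 2"
      using new_faces[of "E - {e}" e] e by auto
  qed
  finally show ?thesis by simp
qed

text \<open>Euler's inequality with girth 3. With at most one face, Euler alone leaves at most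
  \<open>card V - 1\<close> edges, which suffices from three vertices on.\<close>

lemma edge_bound:
  assumes "card V \<ge> 3"
  shows "card E + 6 \<le> 3 * card V"
proof (cases "card (faces E) \<ge> 2")
  case True
  have "3 * card (faces E) \<le> 2 * card E"
  proof (rule girth_bound[OF _ True])
    fix T assume T: "T \<subseteq> E" "T \<noteq> {}" "card T < 3"
    then have "card T = 1 \<or> card T = 2"
      using finite_edges by (auto simp: card_gt_0_iff less_Suc_eq numeral_3_eq_3 numeral_2_eq_2)
    then show "\<exists>e\<in>T. \<exists>x\<in>e. x \<notin> \<Union>(T - {e})"
    proof
      assume "card T = 1"
      then obtain e where "T = {e}" by (metis card_1_singletonE)
      then show ?thesis using edge T by fastforce
    next
      assume "card T = 2"
      then obtain e f where ef: "T = {e, f}" "e \<noteq> f" by (auto simp: card_2_iff)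
      have "\<not> e \<subseteq> f" using edge[of e] edge[of f] T ef by (auto simp: doubleton_eq_iff)
      then show ?thesis using ef by auto
    qed
  qed
  then show ?thesis
    using Euler_ge[of E] assms by fastforce
next
  case False
  then show ?thesis
    using Euler_ge[of E] assms by fastforce
qed

text \<open>As for \<open>edge_bound\<close>, with girth 4: three edges across a bipartition never
  form a triangle.\<close>

lemma bipartite_edge_bound:
  assumes "card V \<ge> 3" and bip: "\<And>e. e \<in> E \<Longrightarrow> \<exists>a b. e = {a, b} \<and> a \<in> A \<and> b \<notin> A"
  shows "card E + 4 \<le> 2 * card V"
proof (cases "card (faces E) \<ge> 2")
  case True
  have "4 * card (faces E) \<le> 2 * card E"
  proof (rule girth_bound[OF _ True])
    fix T assume T: "T \<subseteq> E" "T \<noteq> {}" "card T < 4"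
    then have "card T = 1 \<or> card T = 2 \<or> card T = 3"
      using finite_edges[OF T(1)] card_gt_0_iff[of T] by linarith
    then show "\<exists>e\<in>T. \<exists>x\<in>e. x \<notin> \<Union>(T - {e})"
    proof (elim disjE)
      assume "card T = 1"
      then obtain e where "T = {e}" by (metis card_1_singletonE)
      then show ?thesis using edge T by fastforce
    next
      assume "card T = 2"
      then obtain e f where ef: "T = {e, f}" "e \<noteq> f" by (auto simp: card_2_iff)
      have "\<not> e \<subseteq> f" using edge[of e] edge[of f] T ef by (auto simp: doubleton_eq_iff)
      then show ?thesis using ef by auto
    next
      assume "card T = 3"
      then obtain e f g where efg: "T = {e, f, g}" "e \<noteq> f" "f \<noteq> g" "e \<noteq> g" by (auto simp: card_3_iff)
      then have "e \<in> E" "f \<in> E" "g \<in> E" using T by auto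
      then obtain a1 b1 a2 b2 a3 b3 where ab: "e = {a1, b1}" "f = {a2, b2}" "g = {a3, b3}"
          "a1 \<in> A" "b1 \<notin> A" "a2 \<in> A" "b2 \<notin> A" "a3 \<in> A" "b3 \<notin> A"
        using bip by meson
      have "T - {e} = {f, g}" "T - {f} = {e, g}" "T - {g} = {e, f}" using efg by auto
      then have *: "?thesis \<longleftrightarrow> (\<exists>x\<in>e. x \<notin> f \<union> g) \<or> (\<exists>x\<in>f. x \<notin> e \<union> g) \<or> (\<exists>x\<in>g. x \<notin> e \<union> f)"
        unfolding efg(1) by simp
      show ?thesis
        unfolding * using efg(2-4) ab by (metis UnE insertE insertI1 insertI2 singletonD)
    qed
  qed
  then show ?thesis
    using Euler_ge[of E] assms by fastforce
next
  case False
  then show ?thesis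
    using Euler_ge[of E] assms by fastforce
qed

end

section \<open>Edge bounds for sets of arcs of a planar graph\<close>

lemma card_symmetric_arcs:
  assumes "finite R" and R: "\<And>u v. (u, v) \<in> R \<Longrightarrow> (v, u) \<in> R \<and> u \<noteq> v"
  shows "card R = 2 * card ((\<lambda>(u, v). {u, v}) ` R)"
proof -
  let ?f = "\<lambda>(u, v). {u, v}"
  have "card R = (\<Sum>e\<in>?f ` R. card {r \<in> R. ?f r = e})"
    using sum.image_gen[OF assms(1), of "\<lambda>_. 1 :: nat" ?f] by simp
  also have "\<dots> = (\<Sum>e\<in>?f ` R. 2)"
  proof (rule sum.cong)
    fix e assume "e \<in> ?f ` R"
    then obtain u v where uv: "(u, v) \<in> R" "e = {u, v}" by auto
    have "{r \<in> R. ?f r = e} = {(u, v), (v, u)}"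
      using R uv by (auto simp: doubleton_eq_iff)
    then show "card {r \<in> R. ?f r = e} = 2"
      using R uv by (simp add: card_insert_if)
  qed simp
  finally show ?thesis by simp
qed

lemma plane_arc_graph_of_arcs:
  assumes G: "pair_graph G" and dr: "plane_drawing G p \<gamma>"
    and R: "R \<subseteq> parcs G" "R \<subseteq> W \<times> W" and W: "W \<subseteq> pverts G"
  shows "plane_arc_graph W ((\<lambda>(u, v). {u, v}) ` R) p \<gamma>"
proof -
  interpret pair_graph G by fact
  have D: "Path_Connected.arc (\<gamma> {u, v})" "{pathstart (\<gamma> {u, v}), pathfinish (\<gamma> {u, v})} = {p u, p v}"
    if "(u, v) \<in> parcs G" for u v
    using dr that unfolding plane_drawing_def by blast+
  have D2: "path_image (\<gamma> {u, v}) \<inter> path_image (\<gamma> {w, x}) = p ` ({u, v} \<inter> {w, x})"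
    if "(u, v) \<in> parcs G" "(w, x) \<in> parcs G" "{u, v} \<noteq> {w, x}" for u v w x
    using dr that unfolding plane_drawing_def by blast
  show ?thesis
  proof
    show "finite W" using W pair_finite_verts finite_subset by blast
    have "inj_on p (pverts G)" using dr by (simp add: plane_drawing_def)
    then show "inj_on p W" using W by (rule inj_on_subset)
  next
    fix e assume "e \<in> (\<lambda>(u, v). {u, v}) ` R"
    then obtain u v where uv: "e = {u, v}" "(u, v) \<in> R" by auto
    then have "(u, v) \<in> parcs G" using R by auto
    then show "Path_Connected.arc (\<gamma> e)" "{pathstart (\<gamma> e), pathfinish (\<gamma> e)} = p ` e"
      using D uv by auto
    show "\<exists>u v. u \<in> W \<and> v \<in> W \<and> u \<noteq> v \<and> e = {u, v}"
      using uv R no_loops' by blast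
    fix e' assume "e' \<in> (\<lambda>(u, v). {u, v}) ` R" and ne: "e \<noteq> e'"
    then obtain w x where "e' = {w, x}" "(w, x) \<in> parcs G" using R by auto
    then show "path_image (\<gamma> e) \<inter> path_image (\<gamma> e') = p ` (e \<inter> e')"
      using D2 \<open>(u, v) \<in> parcs G\<close> uv ne by blast
  qed
qed

text \<open>Both arcs of an edge are in \<open>R\<close>, hence twice the numbers of
  \<open>edge_bound\<close>.\<close>

lemma planar_arc_bound:
  assumes G: "pair_graph G" and "planar G"
    and R: "R \<subseteq> parcs G" "R \<subseteq> W \<times> W" "\<And>u v. (u, v) \<in> R \<Longrightarrow> (v, u) \<in> R"
    and W: "W \<subseteq> pverts G" "card W \<ge> 3"
  shows "card R + 12 \<le> 6 * card W"
proof -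
  interpret pair_graph G by fact
  obtain p \<gamma> where "plane_drawing G p \<gamma>" using \<open>planar G\<close> by (auto simp: planar_def)
  then interpret plane_arc_graph W "(\<lambda>(u, v). {u, v}) ` R" p \<gamma>
    using plane_arc_graph_of_arcs assms by blast
  have "card R = 2 * card ((\<lambda>(u, v). {u, v}) ` R)"
    using R no_loops' pair_finite_arcs finite_subset by (intro card_symmetric_arcs) blast+
  then show ?thesis using edge_bound W by simp
qed

text \<open>All arcs of \<open>R\<close> point from \<open>A\<close> to \<open>B\<close>, so each
  edge is counted once.\<close>

lemma planar_bipartite_arc_bound:
  assumes G: "pair_graph G" and "planar G"
    and R: "R \<subseteq> parcs G" "R \<subseteq> A \<times> B" "A \<inter> B = {}"
    and W: "A \<union> B \<subseteq> pverts G" "card (A \<union> B) \<ge> 3"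
  shows "card R + 4 \<le> 2 * card (A \<union> B)"
proof -
  interpret pair_graph G by fact
  obtain p \<gamma> where "plane_drawing G p \<gamma>" using \<open>planar G\<close> by (auto simp: planar_def)
  moreover have "R \<subseteq> (A \<union> B) \<times> (A \<union> B)" using R by auto
  ultimately interpret plane_arc_graph "A \<union> B" "(\<lambda>(u, v). {u, v}) ` R" p \<gamma>
    using plane_arc_graph_of_arcs assms by blast
  have "inj_on (\<lambda>(u, v). {u, v}) R"
    using R by (fastforce simp: inj_on_def doubleton_eq_iff)
  then have "card ((\<lambda>(u, v). {u, v}) ` R) = card R" by (rule card_image)
  moreover have "\<exists>a b. e = {a, b} \<and> a \<in> A \<and> b \<notin> A" if e: "e \<in> (\<lambda>(u, v). {u, v}) ` R" for e
  proof -
    obtain u v where "e = {u, v}" "(u, v) \<in> R" using e by auto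
    moreover have "u \<in> A" "v \<notin> A" using R \<open>(u, v) \<in> R\<close> by auto
    ultimately show ?thesis by blast
  qed
  ultimately show ?thesis using bipartite_edge_bound[OF W(2), of A] by simp
qed

section \<open>The spectral radius as a Perron eigenvalue\<close>

text \<open>\<open>x\<close> maximises the quadratic form over the nonnegative unit vectors, with
  maximum \<open>\<mu>\<close>. Absolute values extend the bound to all vectors. Raising one
  coordinate of \<open>x\<close> slightly cannot violate it, which gives
  \<open>A i \<le> \<mu> * x i\<close>; weighted by \<open>x\<close>, these inequalities sum to an
  equality.\<close>

lemma Perron_Frobenius_symmetric:
  fixes a :: "'a \<Rightarrow> 'a \<Rightarrow> real"
  assumes fin: "finite V" and ne: "V \<noteq> {}"
    and nonneg: "\<And>u v. a u v \<ge> 0" and sym: "\<And>u v. a u v = a v u"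
  obtains x \<mu> where "\<And>v. x v \<ge> 0" "\<exists>v\<in>V. x v \<noteq> 0"
    "\<And>u. u \<in> V \<Longrightarrow> (\<Sum>v\<in>V. a u v * x v) = \<mu> * x u"
    "\<And>y. (\<Sum>u\<in>V. \<Sum>v\<in>V. a u v * y u * y v) \<le> \<mu> * (\<Sum>v\<in>V. (y v)\<^sup>2)"
proof -
  define q :: "('a \<Rightarrow> real) \<Rightarrow> real" where "q y = (\<Sum>u\<in>V. \<Sum>v\<in>V. a u v * y u * y v)" for y
  define N :: "('a \<Rightarrow> real) \<Rightarrow> real" where "N y = (\<Sum>v\<in>V. (y v)\<^sup>2)" for y
  \<comment> \<open>Functions carry the product topology; fixing the coordinates outside
    \<open>V\<close> to 0 makes \<open>B\<close> compact by Tychonoff's theorem.\<close>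
  define B :: "('a \<Rightarrow> real) set" where "B = (\<Pi>\<^sub>E v\<in>UNIV. if v \<in> V then {0..1} else {0})"
  have cont_coord: "continuous_on UNIV (\<lambda>x. x v)" for v :: 'a
    by simp
  have contN: "continuous_on UNIV N" and contq: "continuous_on UNIV q"
    unfolding N_def[abs_def] q_def[abs_def] by (intro continuous_intros cont_coord)+
  have "compact B"
  proof -
    have "compactin (product_topology (\<lambda>_. euclidean) UNIV) B"
      unfolding B_def by (subst compactin_PiE) auto
    then show ?thesis by (simp add: euclidean_product_topology)
  qed
  moreover have "closed {y. N y = 1}"
    using closed_Collect_eq[OF contN continuous_on_const] .
  ultimately have comp: "compact (B \<inter> {y. N y = 1})"
    by (rule compact_Int_closed)
  have mem: "y \<in> B \<inter> {y. N y = 1}" if "\<And>v. v \<in> V \<Longrightarrow> y v \<ge> 0" "\<And>v. v \<notin> V \<Longrightarrow> y v = 0" "N y = 1" for y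
  proof -
    have "y v \<le> 1" if "v \<in> V" for v
    proof -
      have "(y v)\<^sup>2 \<le> N y"
        unfolding N_def using that fin by (intro member_le_sum) auto
      then show ?thesis using \<open>N y = 1\<close> by (simp add: abs_square_le_1)
    qed
    then show ?thesis using that by (auto simp: B_def)
  qed
  obtain w where "w \<in> V" using ne by blast
  have "N (\<lambda>v. if v = w then 1 else 0) = (\<Sum>v\<in>V. if v = w then 1 else 0)"
    unfolding N_def by (intro sum.cong) auto
  then have "N (\<lambda>v. if v = w then 1 else 0) = 1"
    using fin \<open>w \<in> V\<close> by simp
  then have "(\<lambda>v. if v = w then 1 else 0) \<in> B \<inter> {y. N y = 1}"
    using \<open>w \<in> V\<close> by (intro mem) auto
  then have "B \<inter> {y. N y = 1} \<noteq> {}" by blast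
  then obtain x where x: "x \<in> B" "N x = 1" and max: "\<And>y. y \<in> B \<inter> {y. N y = 1} \<Longrightarrow> q y \<le> q x"
    using continuous_attains_sup[OF comp _ continuous_on_subset[OF contq subset_UNIV]] by auto
  define \<mu> where "\<mu> = q x"
  have x0: "x v \<ge> 0" for v
    using x(1) unfolding B_def by (cases "v \<in> V") (auto simp: PiE_iff dest!: spec[of _ v])
  have pos: "q y \<le> \<mu> * N y" if y: "\<And>v. v \<in> V \<Longrightarrow> y v \<ge> 0" for y
  proof (cases "N y = 0")
    case True
    then have "\<And>v. v \<in> V \<Longrightarrow> y v = 0"
      unfolding N_def using fin by (simp add: sum_nonneg_eq_0_iff)
    then show ?thesis using True by (simp add: q_def)
  next
    case False
    have "N y \<ge> 0" by (simp add: N_def sum_nonneg)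
    then have Ny: "N y > 0" using False by simp
    define z where "z v = (if v \<in> V then y v / sqrt (N y) else 0)" for v
    have "N z = (\<Sum>v\<in>V. (y v)\<^sup>2 / N y)"
      unfolding N_def[of z] using Ny by (intro sum.cong) (auto simp: z_def power_divide)
    then have "N z = 1" using Ny by (simp add: sum_divide_distrib[symmetric]) (simp add: N_def)
    then have "q z \<le> \<mu>"
      unfolding \<mu>_def using y Ny by (intro max mem) (auto simp: z_def)
    have "q z = (\<Sum>u\<in>V. \<Sum>v\<in>V. a u v * y u * y v / N y)"
      unfolding q_def using Ny by (intro sum.cong refl) (auto simp: z_def)
    then have "q z = q y / N y"
      by (simp add: q_def sum_divide_distrib)
    then show ?thesis using \<open>q z \<le> \<mu>\<close> Ny by (simp add: pos_divide_le_eq)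
  qed
  have all: "q y \<le> \<mu> * N y" for y
  proof -
    have "q y \<le> q (\<lambda>v. \<bar>y v\<bar>)"
      unfolding q_def using nonneg
      by (intro sum_mono) (simp add: mult.assoc abs_mult[symmetric] mult_left_mono)
    also have "\<dots> \<le> \<mu> * N (\<lambda>v. \<bar>y v\<bar>)" by (rule pos) simp
    finally show ?thesis by (simp add: N_def)
  qed
  define A where "A u = (\<Sum>v\<in>V. a u v * x v)" for u
  have A0: "A u \<ge> 0" for u unfolding A_def using x0 nonneg by (intro sum_nonneg) simp
  have qA: "q x = (\<Sum>u\<in>V. x u * A u)"
    unfolding q_def A_def by (simp add: sum_distrib_left mult_ac)
  have le: "A i \<le> \<mu> * x i" if i: "i \<in> V" for i
  proof (rule ccontr)
    assume "\<not> A i \<le> \<mu> * x i"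
    then have d: "A i - \<mu> * x i > 0" by simp
    define D where "D = A i - \<mu> * x i"
    \<comment> \<open>After division by \<open>t\<close> the bound for the raised vector reads
      \<open>2 * D + t * a i i \<le> \<mu> * t\<close>; this \<open>t\<close> makes the right side
      at most \<open>D\<close>.\<close>
    define t where "t = (A i - \<mu> * x i) / (\<bar>\<mu>\<bar> + 1)"
    have t: "t > 0" using d by (simp add: t_def)
    define e :: "'a \<Rightarrow> real" where "e v = (if v = i then t else 0)" for v
    have se: "(\<Sum>v\<in>V. f v * e v) = f i * t" for f
      using fin i by (simp add: e_def if_distrib[of "\<lambda>x. f _ * x"] cong: if_cong)
    have "q (\<lambda>v. x v + e v) = (\<Sum>u\<in>V. \<Sum>v\<in>V. a u v * x u * x v) + (\<Sum>u\<in>V. \<Sum>v\<in>V. a u v * x u * e v)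
       + (\<Sum>u\<in>V. \<Sum>v\<in>V. a u v * e u * x v) + (\<Sum>u\<in>V. \<Sum>v\<in>V. a u v * e u * e v)"
      unfolding q_def by (simp add: algebra_simps sum.distrib)
    also have "(\<Sum>u\<in>V. \<Sum>v\<in>V. a u v * x u * e v) = t * A i"
      unfolding se A_def by (simp add: sum_distrib_left sym[of _ i] mult_ac)
    also have "(\<Sum>u\<in>V. \<Sum>v\<in>V. a u v * e u * x v) = (\<Sum>u\<in>V. A u * e u)"
      unfolding A_def by (simp add: sum_distrib_left sum_distrib_right mult_ac)
    also have "(\<Sum>u\<in>V. A u * e u) = t * A i"
      by (subst se) simp
    also have "(\<Sum>u\<in>V. \<Sum>v\<in>V. a u v * e u * e v) = (\<Sum>u\<in>V. (a u i * t) * e u)"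
      by (rule sum.cong[OF refl]) (subst se, simp)
    also have "(\<Sum>u\<in>V. (a u i * t) * e u) = t * t * a i i"
      by (subst se) simp
    finally have 1: "q (\<lambda>v. x v + e v) = \<mu> + 2 * t * A i + t * t * a i i"
      by (simp add: \<mu>_def q_def[of x])
    have "N (\<lambda>v. x v + e v) = (\<Sum>v\<in>V. (x v)\<^sup>2 + 2 * (x v * e v) + e v * e v)"
      unfolding N_def by (intro sum.cong refl) (simp add: power2_eq_square algebra_simps)
    also have "\<dots> = N x + 2 * (\<Sum>v\<in>V. x v * e v) + (\<Sum>v\<in>V. e v * e v)"
      by (simp add: N_def sum.distrib sum_distrib_left)
    also have "\<dots> = 1 + 2 * t * x i + t * t"
      unfolding se using x by (simp add: e_def)
    finally have 2: "N (\<lambda>v. x v + e v) = 1 + 2 * t * x i + t * t" .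
    have "\<mu> + 2 * t * A i + t * t * a i i \<le> \<mu> * (1 + 2 * t * x i + t * t)"
      using all[of "\<lambda>v. x v + e v"] unfolding 1 2 .
    then have "t * (2 * (A i - \<mu> * x i) + t * a i i) \<le> t * (\<mu> * t)"
      by (simp add: algebra_simps)
    then have "2 * (A i - \<mu> * x i) + t * a i i \<le> \<mu> * t" using t by simp
    moreover have "t * a i i \<ge> 0" using t nonneg by simp
    moreover have "\<mu> * t \<le> A i - \<mu> * x i"
    proof -
      have "\<mu> * t \<le> (\<bar>\<mu>\<bar> + 1) * t" using t by (intro mult_right_mono) auto
      then show ?thesis by (simp add: t_def)
    qed
    ultimately show False using d unfolding D_def[symmetric] by linarith
  qed
  have "(\<Sum>u\<in>V. x u * (\<mu> * x u - A u)) = (\<Sum>u\<in>V. \<mu> * (x u)\<^sup>2 - x u * A u)"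
    by (rule sum.cong) (simp_all add: algebra_simps power2_eq_square)
  also have "\<dots> = \<mu> * N x - q x"
    by (simp add: qA N_def sum_subtractf sum_distrib_left)
  also have "\<dots> = 0" using x by (simp add: \<mu>_def)
  finally have z: "x u * (\<mu> * x u - A u) = 0" if "u \<in> V" for u
    using sum_nonneg_eq_0_iff[OF fin, of "\<lambda>u. x u * (\<mu> * x u - A u)"] le x0 that by simp
  show ?thesis
  proof
    show "x v \<ge> 0" for v by (rule x0)
    show "\<exists>v\<in>V. x v \<noteq> 0"
    proof (rule ccontr)
      assume "\<not> ?thesis"
      then have "N x = 0" by (simp add: N_def)
      then show False using x by simp
    qed
    show "(\<Sum>v\<in>V. a u v * x v) = \<mu> * x u" if u: "u \<in> V" for u
    proof -
      \<comment> \<open>Where \<open>x u = 0\<close>, the value is squeezed between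
        \<open>0 \<le> A u\<close> and \<open>A u \<le> \<mu> * x u\<close>.\<close>
      have "A u = \<mu> * x u"
        using z[OF u] le[OF u] A0[of u] by (cases "x u = 0") auto
      then show ?thesis by (simp add: A_def)
    qed
    show "(\<Sum>u\<in>V. \<Sum>v\<in>V. a u v * y u * y v) \<le> \<mu> * (\<Sum>v\<in>V. (y v)\<^sup>2)" for y
      using all[of y] by (simp add: q_def N_def)
  qed
qed

section \<open>Eigenvalues through functions on the vertices\<close>

text \<open>The adjacency matrix as an operator on functions, free of any numbering of the
  vertices.\<close>

definition adjacent_sum :: "'a pair_pre_digraph \<Rightarrow> ('a \<Rightarrow> real) \<Rightarrow> 'a \<Rightarrow> real" where
  "adjacent_sum G x u = (\<Sum>v | v \<in> pverts G \<and> (u, v) \<in> parcs G. x v)"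

lemma eigenvalue_adjacency_matrix_iff:
  fixes G :: "'a::linorder pair_pre_digraph"
  assumes fin: "finite (pverts G)"
  shows "eigenvalue (adjacency_matrix G) k \<longleftrightarrow>
    (\<exists>x. (\<exists>v\<in>pverts G. x v \<noteq> 0) \<and> (\<forall>u\<in>pverts G. adjacent_sum G x u = k * x u))"
proof -
  define vs where "vs = sorted_list_of_set (pverts G)"
  define n where "n = card (pverts G)"
  have vs: "set vs = pverts G" "distinct vs" "length vs = n"
    using fin by (auto simp: vs_def n_def)
  have bij: "bij_betw ((!) vs) {..<n} (pverts G)"
    using bij_betw_nth[OF vs(2)] vs by auto
  define M where "M = adjacency_matrix G"
  have M: "M = Matrix.mat n n (\<lambda>(i, j). if (vs ! i, vs ! j) \<in> parcs G then 1 else 0)"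
    by (simp add: M_def adjacency_matrix_def vs_def n_def Let_def)
  have mult: "(M *\<^sub>v y) $ i = adjacent_sum G x (vs ! i)"
    if "y \<in> carrier_vec n" "i < n" "\<And>j. j < n \<Longrightarrow> x (vs ! j) = y $ j" for x y i
  proof -
    have "(M *\<^sub>v y) $ i = (\<Sum>j<n. (if (vs ! i, vs ! j) \<in> parcs G then 1 else 0) * y $ j)"
      using that by (simp add: M scalar_prod_def lessThan_atLeast0)
    also have "\<dots> = (\<Sum>j<n. if (vs ! i, vs ! j) \<in> parcs G then x (vs ! j) else 0)"
      using that by (intro sum.cong) auto
    also have "\<dots> = (\<Sum>v\<in>pverts G. if (vs ! i, v) \<in> parcs G then x v else 0)"
      by (rule sum.reindex_bij_betw[OF bij])
    also have "\<dots> = adjacent_sum G x (vs ! i)"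
      unfolding adjacent_sum_def using fin by (simp add: sum.inter_filter)
    finally show ?thesis .
  qed
  have dim: "dim_row M = n" by (simp add: M)
  show ?thesis
    unfolding M_def[symmetric]
  proof
    assume "eigenvalue M k"
    then obtain y where y: "y \<in> carrier_vec n" "y \<noteq> 0\<^sub>v n" "M *\<^sub>v y = k \<cdot>\<^sub>v y"
      by (auto simp: eigenvalue_def eigenvector_def dim)
    define x where "x v = y $ (the_inv_into {..<n} ((!) vs) v)" for v
    have xy: "x (vs ! j) = y $ j" if "j < n" for j
      using that bij by (simp add: x_def the_inv_into_f_f bij_betw_def)
    show "\<exists>x. (\<exists>v\<in>pverts G. x v \<noteq> 0) \<and> (\<forall>u\<in>pverts G. adjacent_sum G x u = k * x u)"
    proof (intro exI conjI ballI)
      obtain i where "i < n" "y $ i \<noteq> 0" using y(1,2) by (metis carrier_vecD eq_vecI index_zero_vec(1,2))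
      then show "\<exists>v\<in>pverts G. x v \<noteq> 0" using xy vs by (metis nth_mem)
      fix u assume "u \<in> pverts G"
      then obtain i where i: "i < n" "u = vs ! i" using vs by (metis in_set_conv_nth)
      have "adjacent_sum G x u = (M *\<^sub>v y) $ i" using mult[OF y(1) i(1), of x] i xy by simp
      then show "adjacent_sum G x u = k * x u" using y i xy by simp
    qed
  next
    assume "\<exists>x. (\<exists>v\<in>pverts G. x v \<noteq> 0) \<and> (\<forall>u\<in>pverts G. adjacent_sum G x u = k * x u)"
    then obtain x where x: "\<exists>v\<in>pverts G. x v \<noteq> 0" "\<And>u. u \<in> pverts G \<Longrightarrow> adjacent_sum G x u = k * x u"
      by blast
    define y where "y = Matrix.vec n (\<lambda>i. x (vs ! i))"
    have "y \<noteq> 0\<^sub>v n"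
    proof
      assume "y = 0\<^sub>v n"
      then have "x (vs ! i) = 0" if "i < n" for i
        using that by (metis y_def index_vec index_zero_vec(1))
      then show False using x(1) vs by (metis in_set_conv_nth)
    qed
    moreover have "M *\<^sub>v y = k \<cdot>\<^sub>v y"
    proof (rule eq_vecI)
      fix i assume "i < dim_vec (k \<cdot>\<^sub>v y)"
      then have i: "i < n" by (simp add: y_def)
      then have "vs ! i \<in> pverts G" using vs(1,3) by (metis nth_mem)
      then have "adjacent_sum G x (vs ! i) = k * x (vs ! i)" by (rule x(2))
      moreover have "(M *\<^sub>v y) $ i = adjacent_sum G x (vs ! i)"
        using i by (intro mult) (simp_all add: y_def)
      ultimately show "(M *\<^sub>v y) $ i = (k \<cdot>\<^sub>v y) $ i"
        using i by (simp add: y_def)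
    qed (simp add: dim y_def)
    moreover have "y \<in> carrier_vec n" by (simp add: y_def)
    ultimately show "eigenvalue M k"
      unfolding eigenvalue_def eigenvector_def dim by (intro exI[of _ y] conjI)
  qed
qed

text \<open>The Perron value \<open>\<mu>\<close> is an eigenvalue and, by the Rayleigh bound, at
  least every other one. The eigenvalues are roots of the characteristic polynomial, hence finitely
  many, so \<open>Max\<close> is \<open>\<mu>\<close>.\<close>

lemma graph_spectral_radius_Perron:
  fixes G :: "'a::linorder pair_pre_digraph"
  assumes G: "pair_graph G" and ne: "pverts G \<noteq> {}"
  obtains x where "\<And>v. x v \<ge> 0" "\<exists>v\<in>pverts G. x v \<noteq> 0"
    "\<And>u. u \<in> pverts G \<Longrightarrow> adjacent_sum G x u = graph_spectral_radius G * x u"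
    "\<And>y. (\<Sum>u\<in>pverts G. y u * adjacent_sum G y u) \<le> graph_spectral_radius G * (\<Sum>v\<in>pverts G. (y v)\<^sup>2)"
proof -
  interpret pair_graph G by fact
  let ?V = "pverts G"
  have fin: "finite ?V" by (rule pair_finite_verts)
  define a :: "'a \<Rightarrow> 'a \<Rightarrow> real" where "a u v = (if (u, v) \<in> parcs G then 1 else 0)" for u v
  have adj: "(\<Sum>v\<in>?V. a u v * y v) = adjacent_sum G y u" for u y
    unfolding adjacent_sum_def a_def using fin by (simp add: sum.inter_filter if_distrib[of "\<lambda>x. x * _"] cong: if_cong)
  have "a u v \<ge> 0" "a u v = a v u" for u v
    using arcs_symmetric by (auto simp: a_def)
  then obtain x \<mu> where x: "\<And>v. x v \<ge> 0" "\<exists>v\<in>?V. x v \<noteq> 0"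
    "\<And>u. u \<in> ?V \<Longrightarrow> (\<Sum>v\<in>?V. a u v * x v) = \<mu> * x u"
    and R: "\<And>y. (\<Sum>u\<in>?V. \<Sum>v\<in>?V. a u v * y u * y v) \<le> \<mu> * (\<Sum>v\<in>?V. (y v)\<^sup>2)"
    by (rule Perron_Frobenius_symmetric[OF fin ne, of a]) blast
  have R': "(\<Sum>u\<in>?V. y u * adjacent_sum G y u) \<le> \<mu> * (\<Sum>v\<in>?V. (y v)\<^sup>2)" for y
    using R[of y] by (simp add: adj[symmetric] sum_distrib_left mult_ac)
  let ?M = "adjacency_matrix G"
  have M: "?M \<in> carrier_mat (card ?V) (card ?V)" by (simp add: adjacency_matrix_def Let_def)
  have "finite {k. eigenvalue ?M k}"
    unfolding eigenvalue_root_char_poly[OF M] using degree_monic_char_poly[OF M]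
    by (intro poly_roots_finite) (metis leading_coeff_0_iff zero_neq_one)
  moreover have "eigenvalue ?M \<mu>"
    unfolding eigenvalue_adjacency_matrix_iff[OF fin] using x by (auto simp: adj)
  moreover have "k \<le> \<mu>" if k: "eigenvalue ?M k" for k
  proof -
    obtain y v where y: "v \<in> ?V" "y v \<noteq> 0" "\<And>u. u \<in> ?V \<Longrightarrow> adjacent_sum G y u = k * y u"
      using k unfolding eigenvalue_adjacency_matrix_iff[OF fin] by blast
    have "k * (\<Sum>v\<in>?V. (y v)\<^sup>2) = (\<Sum>u\<in>?V. y u * adjacent_sum G y u)"
      using y(3) by (simp add: sum_distrib_left power2_eq_square mult_ac)
    also have "\<dots> \<le> \<mu> * (\<Sum>v\<in>?V. (y v)\<^sup>2)" by (rule R')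
    finally show ?thesis
      using y fin by (metis mult_right_le_imp_le sum_pos2 zero_le_power2 zero_less_power2)
  qed
  ultimately have "graph_spectral_radius G = \<mu>"
    unfolding graph_spectral_radius_def by (intro Max_eqI) auto
  then show ?thesis
    by (intro that[of x]) (use x R' in \<open>simp_all add: adj\<close>)
qed

section \<open>The upper bound\<close>

definition nbrs :: "'a pair_pre_digraph \<Rightarrow> 'a \<Rightarrow> 'a set" where
  "nbrs G v = {u. (v, u) \<in> parcs G}"

context pair_graph
begin

lemma nbrs_subset: "nbrs G v \<subseteq> pverts G"
  using in_arcsD2 by (auto simp: nbrs_def)

lemma finite_nbrs: "finite (nbrs G v)"
  using nbrs_subset pair_finite_verts finite_subset by blast

lemma not_in_nbrs: "v \<notin> nbrs G v"
  using no_loops' by (auto simp: nbrs_def)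

lemma nbrs_sym: "u \<in> nbrs G v \<longleftrightarrow> v \<in> nbrs G u"
  using arcs_symmetric by (auto simp: nbrs_def)

text \<open>\<open>R0\<close> holds the arcs inside the neighbourhood, \<open>R2\<close> those
  leaving it. Together with the \<open>2 * d\<close> arcs at \<open>v\<close>, \<open>R0\<close>
  gives \<open>card R0 + 6 \<le> 4 * d\<close>; the bipartite bound gives
  \<open>card R2 + 4 \<le> 2 * n\<close>. If both are tight, the bound
  \<open>card R0 + 2 * card R2 + 12 \<le> 6 * n\<close> for all these edges yields the second
  claim.\<close>

lemma two_step_walks_planar:
  assumes "planar G" and v: "v \<in> pverts G" and n: "card (pverts G) \<ge> 6"
  shows "(\<Sum>u\<in>nbrs G v. card (nbrs G u)) + 10 \<le> 2 * card (pverts G) + 4 * card (nbrs G v)"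
    and "(\<Sum>u\<in>nbrs G v. card (nbrs G u)) + 10 = 2 * card (pverts G) + 4 * card (nbrs G v) \<Longrightarrow>
      2 * card (nbrs G v) \<le> card (pverts G) + 1"
proof -
  let ?N = "nbrs G v" and ?V = "pverts G"
  define d n where "d = card ?N" and "n = card ?V"
  let ?s = "\<Sum>u\<in>?N. card (nbrs G u)"
  note fin = finite_nbrs pair_finite_verts
  have "?s + 10 \<le> 2 * n + 4 * d \<and> (?s + 10 = 2 * n + 4 * d \<longrightarrow> 2 * d \<le> n + 1)"
  proof (cases "d \<ge> 2")
    \<comment> \<open>For degrees 0 and 1, \<open>insert v ?N\<close> is too small for the edge
      bound.\<close>
    case False
    then consider "d = 0" | "d = 1" by linarith
    then show ?thesis
    proof cases
      case 1
      then have "?N = {}" using fin by (simp add: d_def)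
      then show ?thesis using 1 n by (simp add: n_def)
    next
      case 2
      then obtain u where u: "?N = {u}" unfolding d_def by (metis card_1_singletonE)
      have "u \<in> ?V" using u nbrs_subset by blast
      moreover have "nbrs G u \<subseteq> ?V - {u}" using nbrs_subset not_in_nbrs by blast
      ultimately have "card (nbrs G u) \<le> n - 1"
        using card_mono[of "?V - {u}" "nbrs G u"] fin by (simp add: n_def)
      moreover have "?s = card (nbrs G u)" using u by simp
      ultimately show ?thesis using 2 n unfolding n_def by linarith
    qed
  next
    case True
    define R0 where "R0 = (SIGMA u:?N. nbrs G u \<inter> ?N)"
    define R2 where "R2 = (SIGMA u:?N. nbrs G u - ?N)"
    have sub: "R0 \<subseteq> parcs G" "R2 \<subseteq> parcs G" by (auto simp: R0_def R2_def nbrs_def)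
    have finR: "finite R0" "finite R2" using fin by (auto simp: R0_def R2_def)
    have "?s = (\<Sum>u\<in>?N. card (nbrs G u \<inter> ?N) + card (nbrs G u - ?N))"
      using fin by (intro sum.cong refl) (metis card_Int_Diff)
    also have "\<dots> = card R0 + card R2"
      using fin by (simp add: R0_def R2_def sum.distrib)
    finally have s: "?s = card R0 + card R2" .
    have "card R2 + 4 \<le> 2 * card (?N \<union> (?V - ?N))"
    proof (rule planar_bipartite_arc_bound[OF pair_graph \<open>planar G\<close> sub(2)])
      show "R2 \<subseteq> ?N \<times> (?V - ?N)" using nbrs_subset by (auto simp: R2_def)
      show "?N \<union> (?V - ?N) \<subseteq> ?V" "3 \<le> card (?N \<union> (?V - ?N))"
        using nbrs_subset[of v] n by (auto simp: Un_absorb1)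
    qed auto
    then have r2: "card R2 + 4 \<le> 2 * n" using nbrs_subset[of v] by (simp add: n_def Un_absorb1)
    have "card (R0 \<union> {v} \<times> ?N \<union> ?N \<times> {v}) + 12 \<le> 6 * card (insert v ?N)"
    proof (rule planar_arc_bound[OF pair_graph \<open>planar G\<close>])
      show "R0 \<union> {v} \<times> ?N \<union> ?N \<times> {v} \<subseteq> parcs G"
        using sub arcs_symmetric by (auto simp: nbrs_def)
      show "R0 \<union> {v} \<times> ?N \<union> ?N \<times> {v} \<subseteq> insert v ?N \<times> insert v ?N"
        by (auto simp: R0_def)
      show "(b, a) \<in> R0 \<union> {v} \<times> ?N \<union> ?N \<times> {v}" if "(a, b) \<in> R0 \<union> {v} \<times> ?N \<union> ?N \<times> {v}" for a b
        using that nbrs_sym by (auto simp: R0_def)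
      show "insert v ?N \<subseteq> ?V" using v nbrs_subset by auto
      show "3 \<le> card (insert v ?N)" using True fin not_in_nbrs by (simp add: d_def)
    qed
    moreover have "card (R0 \<union> {v} \<times> ?N \<union> ?N \<times> {v}) = card R0 + d + d"
    proof -
      have disj: "R0 \<inter> {v} \<times> ?N = {}" "(R0 \<union> {v} \<times> ?N) \<inter> ?N \<times> {v} = {}"
        using not_in_nbrs by (auto simp: R0_def)
      show ?thesis
        using fin finR disj by (simp add: card_Un_disjoint d_def card_cartesian_product)
    qed
    ultimately have r0: "card R0 + 6 \<le> 4 * d"
      using fin not_in_nbrs[of v] by (simp add: d_def)
    have "card (R0 \<union> R2 \<union> R2\<inverse>) + 12 \<le> 6 * card ?V"
    proof (rule planar_arc_bound[OF pair_graph \<open>planar G\<close>])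
      show *: "R0 \<union> R2 \<union> R2\<inverse> \<subseteq> parcs G" using sub arcs_symmetric by auto
      then show "R0 \<union> R2 \<union> R2\<inverse> \<subseteq> ?V \<times> ?V" using in_arcsD1 in_arcsD2 by auto
      show "(b, a) \<in> R0 \<union> R2 \<union> R2\<inverse>" if "(a, b) \<in> R0 \<union> R2 \<union> R2\<inverse>" for a b
        using that nbrs_sym by (auto simp: R0_def)
    qed (use n in auto)
    moreover have "card (R0 \<union> R2 \<union> R2\<inverse>) = card R0 + card R2 + card R2"
    proof -
      have "R0 \<inter> R2 = {}" "(R0 \<union> R2) \<inter> R2\<inverse> = {}" by (auto simp: R0_def R2_def)
      then show ?thesis using finR by (simp add: card_Un_disjoint)
    qed
    ultimately have "card R0 + card R2 + card R2 + 12 \<le> 6 * n" by (simp add: n_def)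
    then show ?thesis using s r0 r2 by linarith
  qed
  then show "?s + 10 \<le> 2 * card ?V + 4 * card ?N" "?s + 10 = 2 * card ?V + 4 * card ?N \<Longrightarrow> 2 * card ?N \<le> card ?V + 1"
    by (auto simp: d_def n_def)
qed

text \<open>
  Tightness gives all degrees in \<open>S\<close> at most \<open>(n + 1) / 2\<close>, so the neighbours of a vertex of degree at most
  4 cannot provide enough walks. Hence the smallest degree in \<open>S\<close> is 5, which forces \<open>15 \<le> n\<close>; summing
  over \<open>S\<close>, convexity of \<open>d\<^sup>2\<close> and the edge bound then contradict tightness.
\<close>

lemma two_step_walks_not_tight:
  assumes "planar G" and n: "card (pverts G) \<ge> 10"
    and S: "S \<subseteq> pverts G" "S \<noteq> {}" "\<And>v. v \<in> S \<Longrightarrow> nbrs G v \<subseteq> S"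
    and tight: "\<And>v. v \<in> S \<Longrightarrow> (\<Sum>u\<in>nbrs G v. card (nbrs G u)) + 10 = 2 * card (pverts G) + 4 * card (nbrs G v)"
  shows False
proof -
  define n where "n = card (pverts G)"
  define d where "d v = card (nbrs G v)" for v
  have n10: "n \<ge> 10" using n by (simp add: n_def)
  have finS: "finite S" using S pair_finite_verts finite_subset by blast
  have dmax: "2 * d v \<le> n + 1" if "v \<in> S" for v
    using two_step_walks_planar(2)[OF \<open>planar G\<close> _ _ tight] that S n by (auto simp: d_def n_def)
  have walks: "(\<Sum>u\<in>nbrs G v. d u) + 10 = 2 * n + 4 * d v" if "v \<in> S" for v
    using tight[OF that] by (simp add: d_def n_def)
  \<comment> \<open>The walk sum is fixed by tightness and bounded by the maximal degree. For degree
    at most 4 this is impossible; for degree 5 it means \<open>15 \<le> n\<close>.\<close>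
  have key: "4 * n + 8 * d v \<le> d v * (n + 1) + 20" if v: "v \<in> S" for v
  proof -
    have "2 * (\<Sum>u\<in>nbrs G v. d u) = (\<Sum>u\<in>nbrs G v. 2 * d u)" by (simp add: sum_distrib_left)
    also have "\<dots> \<le> (\<Sum>u\<in>nbrs G v. n + 1)"
      using S(3)[OF v] dmax by (intro sum_mono) blast
    also have "\<dots> = d v * (n + 1)" by (simp add: d_def)
    finally show ?thesis using walks[OF v] by linarith
  qed
  have dmin: "5 \<le> d v" if v: "v \<in> S" for v
  proof (rule ccontr)
    assume "\<not> 5 \<le> d v"
    then have "d v = 0 \<or> d v = 1 \<or> d v = 2 \<or> d v = 3 \<or> d v = 4" by linarith
    then show False using key[OF v] n10 by auto
  qed
  obtain w where w: "w \<in> S" using S by blast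
  have "card S \<ge> 3"
    using card_mono[OF finS S(3)[OF w]] dmin[OF w] by (simp add: d_def)
  have "card (SIGMA v:S. nbrs G v) + 12 \<le> 6 * card S"
  proof (rule planar_arc_bound[OF pair_graph \<open>planar G\<close>])
    show "(SIGMA v:S. nbrs G v) \<subseteq> parcs G" by (auto simp: nbrs_def)
    show "(SIGMA v:S. nbrs G v) \<subseteq> S \<times> S" using S by auto
    show "(b, a) \<in> (SIGMA v:S. nbrs G v)" if "(a, b) \<in> (SIGMA v:S. nbrs G v)" for a b
      using that S(3)[of a] nbrs_sym[of a b] by auto
  qed (use S \<open>card S \<ge> 3\<close> in auto)
  then have edges: "(\<Sum>v\<in>S. d v) + 12 \<le> 6 * card S"
    using finS finite_nbrs by (simp add: d_def)
  have "\<exists>v\<in>S. d v \<le> 5"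
  proof (rule ccontr)
    assume "\<not> ?thesis"
    then have "(\<Sum>v\<in>S. 6) \<le> (\<Sum>v\<in>S. d v)" by (intro sum_mono) auto
    then show False using edges by simp
  qed
  then obtain v where v: "v \<in> S" "d v = 5" using dmin by (meson le_antisym)
  have n15: "n \<ge> 15" using key[OF v(1)] v(2) by simp
  have nb: "nbrs G v = {u. u \<in> S \<and> u \<in> nbrs G v}" if "v \<in> S" for v
    using S(3)[OF that] by auto
  \<comment> \<open>Each \<open>u\<close> is counted once per neighbour, so the total is the sum of
    the squared degrees.\<close>
  have "(\<Sum>v\<in>S. \<Sum>u\<in>nbrs G v. d u) = (\<Sum>v\<in>S. \<Sum>u | u \<in> S \<and> u \<in> nbrs G v. d u)"
    using nb by (intro sum.cong) auto
  also have "\<dots> = (\<Sum>u\<in>S. \<Sum>v | v \<in> S \<and> u \<in> nbrs G v. d u)"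
    by (rule sum.swap_restrict[OF finS finS])
  also have "\<dots> = (\<Sum>u\<in>S. d u * d u)"
  proof (rule sum.cong)
    fix u assume "u \<in> S"
    then have "{v. v \<in> S \<and> u \<in> nbrs G v} = nbrs G u" using nb[of u] nbrs_sym[of u] by auto
    then show "(\<Sum>v | v \<in> S \<and> u \<in> nbrs G v. d u) = d u * d u" by (simp add: d_def)
  qed simp
  finally have sq: "(\<Sum>u\<in>S. d u * d u) + 10 * card S = 2 * n * card S + 4 * (\<Sum>v\<in>S. d v)"
  proof -
    assume "(\<Sum>v\<in>S. \<Sum>u\<in>nbrs G v. d u) = (\<Sum>u\<in>S. d u * d u)"
    moreover have "(\<Sum>v\<in>S. (\<Sum>u\<in>nbrs G v. d u) + 10) = (\<Sum>v\<in>S. 2 * n + 4 * d v)"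
      using walks by (intro sum.cong) auto
    ultimately show ?thesis
      by (simp add: sum.distrib sum_distrib_left[symmetric] sum_distrib_right[symmetric] mult_ac)
  qed
  \<comment> \<open>Degrees lie between 5 and \<open>(n + 1) / 2\<close>, so
    \<open>d\<^sup>2\<close> is below its chord over this interval:
    \<open>(d - 5) * (n + 1 - 2 * d) \<ge> 0\<close>.\<close>
  have "2 * (d v * d v) + 5 * (n + 1) \<le> (n + 11) * d v" if "v \<in> S" for v
  proof -
    have "(int (d v) - 5) * (int n + 1 - 2 * int (d v)) \<ge> 0"
      using dmin[OF that] dmax[OF that] by (intro mult_nonneg_nonneg) auto
    then have "int (2 * (d v * d v) + 5 * (n + 1)) \<le> int ((n + 11) * d v)"
      by (simp add: algebra_simps)
    then show ?thesis by linarith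
  qed
  then have "(\<Sum>v\<in>S. 2 * (d v * d v) + 5 * (n + 1)) \<le> (\<Sum>v\<in>S. (n + 11) * d v)"
    by (rule sum_mono)
  then have chord: "2 * (\<Sum>v\<in>S. d v * d v) + 5 * (n + 1) * card S \<le> (n + 11) * (\<Sum>v\<in>S. d v)"
    by (simp only: sum.distrib sum_distrib_left sum_constant) (simp add: mult_ac)
  define m e q where "m = int (card S)" and "e = int (\<Sum>v\<in>S. d v)" and "q = int (\<Sum>v\<in>S. d v * d v)"
  have 1: "q + 10 * m = 2 * int n * m + 4 * e"
    using arg_cong[OF sq, of int] by (simp add: m_def e_def q_def)
  have 2: "2 * q + 5 * (int n + 1) * m \<le> (int n + 11) * e"
  proof -
    have "int (2 * (\<Sum>v\<in>S. d v * d v) + 5 * (n + 1) * card S) \<le> int ((n + 11) * (\<Sum>v\<in>S. d v))"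
      using chord by linarith
    then show ?thesis by (simp add: m_def e_def q_def algebra_simps)
  qed
  have 3: "e + 12 \<le> 6 * m" using edges unfolding m_def e_def by linarith
  \<comment> \<open>Eliminating \<open>q\<close> from 1 and 2 leaves
    \<open>9 * n * m - 15 * m \<le> (n + 3) * e\<close>, into which the edge bound 3 is
    inserted.\<close>
  have "(int n + 3) * (e + 12) \<le> (int n + 3) * (6 * m)"
    using 3 by (intro mult_left_mono) auto
  with 1 2 have 4: "3 * (int n * m) + 12 * (int n + 3) \<le> 33 * m"
    by (simp add: algebra_simps)
  have "15 * m \<le> int n * m"
    using n15 by (intro mult_right_mono) (simp_all add: m_def)
  then have "12 * m + 12 * int n + 36 \<le> 0"
    using 4 by (simp add: algebra_simps)
  moreover have "m \<ge> 0" "int n \<ge> 0" by (simp_all add: m_def)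
  ultimately show False by linarith
qed

text \<open>Symmetry of the adjacency matrix.\<close>

lemma sum_adjacent_sum_swap:
  "(\<Sum>u\<in>pverts G. f u * adjacent_sum G g u) = (\<Sum>u\<in>pverts G. g u * adjacent_sum G f u)"
proof -
  have "(\<Sum>u\<in>pverts G. f u * adjacent_sum G g u) =
      (\<Sum>u\<in>pverts G. \<Sum>v | v \<in> pverts G \<and> (u, v) \<in> parcs G. f u * g v)"
    by (simp add: adjacent_sum_def sum_distrib_left)
  also have "\<dots> = (\<Sum>v\<in>pverts G. \<Sum>u | u \<in> pverts G \<and> (u, v) \<in> parcs G. f u * g v)"
    by (rule sum.swap_restrict[OF pair_finite_verts pair_finite_verts])
  also have "\<dots> = (\<Sum>v\<in>pverts G. \<Sum>u | u \<in> pverts G \<and> (v, u) \<in> parcs G. g v * f u)"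
  proof (rule sum.cong[OF refl])
    fix v
    have "{u. u \<in> pverts G \<and> (u, v) \<in> parcs G} = {u. u \<in> pverts G \<and> (v, u) \<in> parcs G}"
      using arcs_symmetric by blast
    then show "(\<Sum>u | u \<in> pverts G \<and> (u, v) \<in> parcs G. f u * g v) =
        (\<Sum>u | u \<in> pverts G \<and> (v, u) \<in> parcs G. g v * f u)"
      by (simp add: mult.commute)
  qed
  also have "\<dots> = (\<Sum>u\<in>pverts G. g u * adjacent_sum G f u)"
    by (simp add: adjacent_sum_def sum_distrib_left)
  finally show ?thesis .
qed

lemma adjacent_sum_nbrs: "adjacent_sum G f u = (\<Sum>v\<in>nbrs G u. f v)"
proof -
  have "{v. v \<in> pverts G \<and> (u, v) \<in> parcs G} = nbrs G u"
    using in_arcsD2 by (auto simp: nbrs_def)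
  then show ?thesis by (simp add: adjacent_sum_def)
qed

end

lemma spectral_radius_planar_less:
  fixes G :: "'a::linorder pair_pre_digraph"
  assumes G: "pair_graph G" and "planar G" and n: "card (pverts G) \<ge> 10"
  shows "graph_spectral_radius G < 2 + sqrt (2 * real (card (pverts G)) - 6)"
proof (rule ccontr)
  interpret pair_graph G by fact
  let ?V = "pverts G"
  define n where "n = card ?V"
  define \<mu> where "\<mu> = graph_spectral_radius G"
  assume "\<not> ?thesis"
  then have \<mu>: "2 + sqrt (2 * real n - 6) \<le> \<mu>" by (simp add: n_def \<mu>_def)
  have n10: "n \<ge> 10" using n by (simp add: n_def)
  have "?V \<noteq> {}" using n by auto
  then obtain x where x: "\<And>v. x v \<ge> 0" "\<exists>v\<in>?V. x v \<noteq> 0"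
    and eig: "\<And>u. u \<in> ?V \<Longrightarrow> adjacent_sum G x u = \<mu> * x u"
    unfolding \<mu>_def by (rule graph_spectral_radius_Perron[OF G]) blast
  have "(sqrt (2 * real n - 6))\<^sup>2 \<le> (\<mu> - 2)\<^sup>2"
    using \<mu> n10 by (intro power_mono) auto
  then have \<mu>2: "2 * real n - 10 \<le> \<mu> * \<mu> - 4 * \<mu>"
    using n10 by (simp add: power2_eq_square algebra_simps)
  have "sqrt (2 * real n - 6) \<ge> 0" using n10 by simp
  then have "\<mu> > 0" using \<mu> by linarith
  \<comment> \<open>In matrix terms \<open>d = A 1\<close> and \<open>e = A\<^sup>2 1\<close>;
    pairing with \<open>x\<close> turns each \<open>A\<close> into a factor
    \<open>\<mu>\<close>.\<close>
  define d e where "d v = real (card (nbrs G v))" and "e v = (\<Sum>u\<in>nbrs G v. d u)" for v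
  have d: "adjacent_sum G (\<lambda>_. 1) u = d u" for u by (simp add: adjacent_sum_nbrs d_def)
  have e: "adjacent_sum G d u = e u" for u by (simp add: adjacent_sum_nbrs e_def)
  have eig_sum: "(\<Sum>v\<in>?V. f v * adjacent_sum G x v) = \<mu> * (\<Sum>v\<in>?V. x v * f v)" for f
    using eig by (simp add: sum_distrib_left mult_ac)
  have dx: "(\<Sum>v\<in>?V. x v * d v) = \<mu> * (\<Sum>v\<in>?V. x v)"
    using sum_adjacent_sum_swap[of x "\<lambda>_. 1"] eig_sum[of "\<lambda>_. 1"] by (simp add: d)
  have ex: "(\<Sum>v\<in>?V. x v * e v) = \<mu> * (\<mu> * (\<Sum>v\<in>?V. x v))"
    using sum_adjacent_sum_swap[of x d] eig_sum[of d] dx by (simp add: e)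
  \<comment> \<open>The slack in the bound on two-step walks. Its pairing with \<open>x\<close> is
    at most 0 by the assumption on \<open>\<mu>\<close>, so \<open>r\<close> vanishes on the support
    of \<open>x\<close>.\<close>
  define r where "r v = 2 * real n - 10 + 4 * d v - e v" for v
  have e_eq: "e v = real (\<Sum>u\<in>nbrs G v. card (nbrs G u))" for v by (simp add: e_def d_def)
  have r0: "r v \<ge> 0" if "v \<in> ?V" for v
  proof -
    have "(\<Sum>u\<in>nbrs G v. card (nbrs G u)) + 10 \<le> 2 * n + 4 * card (nbrs G v)"
      using two_step_walks_planar(1)[OF \<open>planar G\<close> that] n by (simp add: n_def)
    then have "real ((\<Sum>u\<in>nbrs G v. card (nbrs G u)) + 10) \<le> real (2 * n + 4 * card (nbrs G v))"
      by (rule of_nat_mono)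
    then show ?thesis unfolding r_def e_eq d_def by simp
  qed
  have "(\<Sum>v\<in>?V. x v * r v) = (\<Sum>v\<in>?V. (2 * real n - 10) * x v + 4 * (x v * d v) - x v * e v)"
    by (rule sum.cong) (simp_all add: r_def algebra_simps)
  also have "\<dots> = (2 * real n - 10) * (\<Sum>v\<in>?V. x v) + 4 * (\<Sum>v\<in>?V. x v * d v) - (\<Sum>v\<in>?V. x v * e v)"
    by (simp only: sum_subtractf sum.distrib sum_distrib_left)
  also have "\<dots> = (2 * real n - 10 - (\<mu> * \<mu> - 4 * \<mu>)) * (\<Sum>v\<in>?V. x v)"
    unfolding dx ex by (simp add: algebra_simps)
  also have "\<dots> \<le> 0"
    using \<mu>2 x(1) by (intro mult_nonpos_nonneg sum_nonneg) auto
  finally have "(\<Sum>v\<in>?V. x v * r v) \<le> 0" .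
  moreover have nn: "x v * r v \<ge> 0" if "v \<in> ?V" for v using x(1) r0[OF that] by simp
  ultimately have "(\<Sum>v\<in>?V. x v * r v) = 0" by (meson order_antisym sum_nonneg)
  then have xr: "x v * r v = 0" if "v \<in> ?V" for v
    using sum_nonneg_eq_0_iff[OF pair_finite_verts, of "\<lambda>v. x v * r v"] nn that by simp
  \<comment> \<open>The support is closed under neighbours: \<open>\<mu> * x u\<close> is a sum of
    nonnegative values that includes \<open>x v > 0\<close> for each neighbour \<open>v\<close> in
    \<open>S\<close>.\<close>
  define S where "S = {v \<in> ?V. x v \<noteq> 0}"
  show False
  proof (rule two_step_walks_not_tight[OF \<open>planar G\<close> n])
    show "S \<subseteq> ?V" "S \<noteq> {}" using x(2) by (auto simp: S_def)
    fix v assume v: "v \<in> S"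
    show "nbrs G v \<subseteq> S"
    proof
      fix u assume u: "u \<in> nbrs G v"
      then have "u \<in> ?V" using nbrs_subset by auto
      have "x v \<le> adjacent_sum G x u"
        unfolding adjacent_sum_nbrs using u nbrs_sym finite_nbrs x(1) by (intro member_le_sum) auto
      moreover have "x v > 0" using v x(1)[of v] by (simp add: S_def)
      ultimately have "\<mu> * x u > 0" using eig[OF \<open>u \<in> ?V\<close>] by linarith
      then show "u \<in> S" using \<open>u \<in> ?V\<close> by (auto simp: S_def)
    qed
    have "r v = 0" using xr[of v] v by (auto simp: S_def)
    then have "real ((\<Sum>u\<in>nbrs G v. card (nbrs G u)) + 10) = real (2 * n + 4 * card (nbrs G v))"
      unfolding r_def e_eq d_def by simp
    then show "(\<Sum>u\<in>nbrs G v. card (nbrs G u)) + 10 = 2 * card ?V + 4 * card (nbrs G v)"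
      unfolding n_def by (simp only: of_nat_eq_iff)
  qed
qed

section \<open>The lower bound\<close>

text \<open>The join of an edge, whose ends 0 and 1 are the hubs, and the path 2, ..., n -
  1.\<close>

definition fan_graph :: "nat \<Rightarrow> nat pair_pre_digraph" where
  "fan_graph n = \<lparr>pverts = {..<n},
     parcs = {(u, v). u < n \<and> v < n \<and> u \<noteq> v \<and> (u < 2 \<or> v < 2 \<or> u = v + 1 \<or> v = u + 1)}\<rparr>"

text \<open>The hubs are at i and -i, the path at 1, 2, 3, ... on the real axis. With straight
  edges, the hub edge crosses that axis at 0, left of the path.\<close>

definition fan_point :: "nat \<Rightarrow> complex" where
  "fan_point k = Complex (if k < 2 then 0 else real k - 1) (if k = 0 then 1 else if k = 1 then - 1 else 0)"

lemma pair_graph_fan_graph: "pair_graph (fan_graph n)"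
proof
  show "finite (parcs (fan_graph n))"
    by (rule finite_subset[of _ "{..<n} \<times> {..<n}"]) (auto simp: fan_graph_def)
qed (auto simp: fan_graph_def symmetric_def sym_def)

text \<open>Coordinates for the four kinds of edges (hub edge, edges from either hub to the path,
  path edges) turn crossings into real arithmetic.\<close>

lemma fan_segment:
  assumes "a < b" "(a, b) \<in> parcs (fan_graph n)" "z \<in> closed_segment (fan_point a) (fan_point b)"
  shows "(a = 0 \<and> b = 1 \<and> Re z = 0) \<or>
    (a = 0 \<and> 2 \<le> b \<and> Re z = (1 - Im z) * (real b - 1) \<and> 0 \<le> Im z \<and> Im z \<le> 1) \<or>
    (a = 1 \<and> 2 \<le> b \<and> Re z = (1 + Im z) * (real b - 1) \<and> - 1 \<le> Im z \<and> Im z \<le> 0) \<or>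
    (2 \<le> a \<and> b = a + 1 \<and> Im z = 0 \<and> real a - 1 \<le> Re z \<and> Re z \<le> real a)"
proof -
  obtain t where t: "0 \<le> t" "t \<le> 1" and z: "z = (1 - t) *\<^sub>R fan_point a + t *\<^sub>R fan_point b"
    using assms(3) by (auto simp: in_segment)
  have ReIm: "Re z = (1 - t) * Re (fan_point a) + t * Re (fan_point b)"
    "Im z = (1 - t) * Im (fan_point a) + t * Im (fan_point b)"
    by (simp_all add: z)
  consider "a = 0" "b = 1" | "a = 0" "2 \<le> b" | "a = 1" "2 \<le> b" | "2 \<le> a" "b = a + 1"
    using assms(1,2) by (simp add: fan_graph_def) arith
  then show ?thesis
  proof cases
    case 4
    then show ?thesis using t by (simp add: ReIm fan_point_def algebra_simps)
  qed (use t in \<open>simp_all add: ReIm fan_point_def\<close>)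
qed

text \<open>Segments at one hub have different directions. Apart from the hub edge, segments at
  different hubs lie in opposite half planes and reach the real axis only at their ends on the path.
  Two path edges share at most an end.\<close>

lemma fan_segments_meet:
  assumes "a < b" "(a, b) \<in> parcs (fan_graph n)" "z \<in> closed_segment (fan_point a) (fan_point b)"
    and "c < d" "(c, d) \<in> parcs (fan_graph n)" "z \<in> closed_segment (fan_point c) (fan_point d)"
    and ne: "{a, b} \<noteq> {c, d}"
  shows "z \<in> fan_point ` ({a, b} \<inter> {c, d})"
  using assms
proof (induction a c arbitrary: b d rule: linorder_wlog)
  case (sym a c)
  then show ?case by (metis Int_commute)
next
  case (le a c)
  note ab = fan_segment[OF le(2-4)] and cd = fan_segment[OF le(5-7)]
  consider "a = 0" "c = 0" | "a = 0" "c = 1" | "a = 0" "2 \<le> c" | "a = 1" "c = 1" | "a = 1" "2 \<le> c" | "2 \<le> a" "2 \<le> c"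
    using le(1) by linarith
  then show ?case
  proof cases
    case 1
    then have "b \<noteq> d" using le by auto
    have "Re z = 0 \<and> Im z = 1"
    proof (cases "b = 1 \<or> d = 1")
      case True
      then have "(1 - Im z) * (real b - 1) = 0 \<or> (1 - Im z) * (real d - 1) = 0" "Re z = 0"
        using ab cd 1 \<open>b \<noteq> d\<close> by auto
      then show ?thesis using ab cd 1 \<open>b \<noteq> d\<close> by auto
    next
      case False
      then have "(1 - Im z) * (real b - 1) = (1 - Im z) * (real d - 1)" "Re z = (1 - Im z) * (real b - 1)"
        using ab cd 1 by auto
      then show ?thesis using \<open>b \<noteq> d\<close> by auto
    qed
    then have "z = fan_point 0" by (intro complex_eqI) (auto simp: fan_point_def)
    then show ?thesis using 1 by auto
  next
    case 2
    show ?thesis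
    proof (cases "b = 1")
      case True
      then have "(1 + Im z) * (real d - 1) = 0" "Re z = 0" "2 \<le> d" using ab cd 2 by auto
      then have "z = fan_point 1" by (intro complex_eqI) (auto simp: fan_point_def)
      then show ?thesis using 2 True by auto
    next
      case False
      then have *: "Im z = 0" "Re z = real b - 1" "Re z = real d - 1" "2 \<le> b" using ab cd 2 by auto
      then have "z = fan_point b" "b = d" by (auto simp: fan_point_def complex_eq_iff)
      then show ?thesis by auto
    qed
  next
    case 3
    then have *: "Im z = 0" "real c - 1 \<le> Re z" "Re z \<le> real c" "d = c + 1" "Re z = real b - 1" "2 \<le> b"
      using ab cd by auto
    then have "z = fan_point b" "b = c \<or> b = d" by (auto simp: fan_point_def complex_eq_iff)
    then show ?thesis by auto
  next
    case 4
    then have "b \<noteq> d" using le by auto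
    have "(1 + Im z) * (real b - 1) = (1 + Im z) * (real d - 1)" "Re z = (1 + Im z) * (real b - 1)"
      using ab cd 4 by auto
    then have "Re z = 0 \<and> Im z = - 1" using \<open>b \<noteq> d\<close> by auto
    then have "z = fan_point 1" by (intro complex_eqI) (auto simp: fan_point_def)
    then show ?thesis using 4 by auto
  next
    case 5
    then have *: "Im z = 0" "real c - 1 \<le> Re z" "Re z \<le> real c" "d = c + 1" "Re z = real b - 1" "2 \<le> b"
      using ab cd by auto
    then have "z = fan_point b" "b = c \<or> b = d" by (auto simp: fan_point_def complex_eq_iff)
    then show ?thesis by auto
  next
    case 6
    then have *: "Im z = 0" "real c - 1 \<le> Re z" "Re z \<le> real a" "b = a + 1" "d = c + 1" "c \<noteq> a"
      using ab cd le by auto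
    then have "c = b" "Re z = real a" using le(1) by auto
    then have "z = fan_point b" using * 6 by (intro complex_eqI) (auto simp: fan_point_def)
    then show ?thesis using \<open>c = b\<close> by auto
  qed
qed

lemma fan_segment_vertices:
  assumes "a < b" "(a, b) \<in> parcs (fan_graph n)" "fan_point k \<in> closed_segment (fan_point a) (fan_point b)"
  shows "k = a \<or> k = b"
  using fan_segment[OF assms] by (auto simp: fan_point_def split: if_splits)

lemma inj_fan_point: "inj fan_point"
  by (auto simp: inj_def fan_point_def split: if_splits)

lemma planar_fan_graph: "planar (fan_graph n)"
proof -
  \<comment> \<open>Curves are indexed by unordered pairs, so \<open>Min\<close> and
    \<open>Max\<close> fix a direction.\<close>
  define \<gamma> where "\<gamma> e = linepath (fan_point (Min e)) (fan_point (Max e))" for e :: "nat set"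
  let ?p = fan_point
  have edge: "\<exists>a b. a < b \<and> (a, b) \<in> parcs (fan_graph n) \<and> {u, v} = {a, b}" if "(u, v) \<in> parcs (fan_graph n)" for u v
  proof (cases "u < v")
    case True then show ?thesis using that by blast
  next
    case False
    then have "v < u" "(v, u) \<in> parcs (fan_graph n)" "{u, v} = {v, u}" using that by (auto simp: fan_graph_def)
    then show ?thesis by blast
  qed
  have \<gamma>: "\<gamma> {a, b} = linepath (?p a) (?p b)" if "a < b" for a b
    using that by (simp add: \<gamma>_def)
  have 1: "arc (\<gamma> {u, v}) \<and>
      {pathstart (\<gamma> {u, v}), pathfinish (\<gamma> {u, v})} = {?p u, ?p v} \<and>
      path_image (\<gamma> {u, v}) \<inter> ?p ` pverts (fan_graph n) = {?p u, ?p v}"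
    if uv: "(u, v) \<in> parcs (fan_graph n)" for u v
  proof -
    obtain a b where ab: "a < b" "(a, b) \<in> parcs (fan_graph n)" "{u, v} = {a, b}" using edge[OF uv] by blast
    have img: "{?p u, ?p v} = {?p a, ?p b}" using arg_cong[OF ab(3), of "(`) ?p"] by simp
    have "?p a \<noteq> ?p b" using ab(1) inj_fan_point by (metis injD less_irrefl)
    moreover have "closed_segment (?p a) (?p b) \<inter> ?p ` pverts (fan_graph n) = {?p a, ?p b}"
    proof -
      have "a \<in> pverts (fan_graph n)" "b \<in> pverts (fan_graph n)" using ab(2) by (auto simp: fan_graph_def)
      then show ?thesis
        using fan_segment_vertices[OF ab(1,2)] by auto
    qed
    ultimately show ?thesis
      unfolding img ab(3) \<gamma>[OF ab(1)] by (simp add: arc_linepath)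
  qed
  have 2: "path_image (\<gamma> {u, v}) \<inter> path_image (\<gamma> {w, x}) = ?p ` ({u, v} \<inter> {w, x})"
    if uv: "(u, v) \<in> parcs (fan_graph n)" and wx: "(w, x) \<in> parcs (fan_graph n)" and ne: "{u, v} \<noteq> {w, x}" for u v w x
  proof -
    obtain a b where ab: "a < b" "(a, b) \<in> parcs (fan_graph n)" "{u, v} = {a, b}" using edge[OF uv] by blast
    obtain c d where cd: "c < d" "(c, d) \<in> parcs (fan_graph n)" "{w, x} = {c, d}" using edge[OF wx] by blast
    have "closed_segment (?p a) (?p b) \<inter> closed_segment (?p c) (?p d) = ?p ` ({a, b} \<inter> {c, d})"
      using fan_segments_meet[OF ab(1,2) _ cd(1,2)] ne ab(3) cd(3) by auto
    then show ?thesis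
      unfolding ab(3) cd(3) \<gamma>[OF ab(1)] \<gamma>[OF cd(1)] by simp
  qed
  have "plane_drawing (fan_graph n) ?p \<gamma>"
    unfolding plane_drawing_def
  proof (intro conjI)
    show "inj_on ?p (pverts (fan_graph n))"
      using inj_fan_point by (rule inj_on_subset) simp
  qed (intro ballI case_prodI2 impI, hypsubst, rule 1 2; assumption)+
  then show ?thesis unfolding planar_def by blast
qed

section \<open>The maximum is attained, and its numerical estimate from below\<close>

lemma planar_spectral_radii_finite:
  "finite {graph_spectral_radius G | G :: nat pair_pre_digraph.
     pair_graph G \<and> planar G \<and> card (pverts G) = n}"
proof (rule finite_subset)
  let ?M = "\<lambda>R :: (nat \<times> nat) set. Matrix.mat n n (\<lambda>(i, j). if (i, j) \<in> R then 1 else 0 :: real)"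
  show "{graph_spectral_radius G | G :: nat pair_pre_digraph. pair_graph G \<and> planar G \<and> card (pverts G) = n} \<subseteq>
    (\<lambda>M. Max {k. eigenvalue M k}) ` ?M ` Pow ({..<n} \<times> {..<n})"
  proof
    fix r assume "r \<in> {graph_spectral_radius G | G :: nat pair_pre_digraph. pair_graph G \<and> planar G \<and> card (pverts G) = n}"
    then obtain G :: "nat pair_pre_digraph" where r: "r = graph_spectral_radius G" and n: "card (pverts G) = n"
      by blast
    let ?vs = "sorted_list_of_set (pverts G)"
    \<comment> \<open>Arcs by position in the sorted vertex list; for given \<open>n\<close> the
      radius depends on \<open>G\<close> only through \<open>R\<close>.\<close>
    define R where "R = {(i, j). i < n \<and> j < n \<and> (?vs ! i, ?vs ! j) \<in> parcs G}"
    have "adjacency_matrix G = ?M R"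
      unfolding adjacency_matrix_def Let_def n by (rule eq_matI) (auto simp: R_def)
    moreover have "R \<in> Pow ({..<n} \<times> {..<n})" by (auto simp: R_def)
    ultimately show "r \<in> (\<lambda>M. Max {k. eigenvalue M k}) ` ?M ` Pow ({..<n} \<times> {..<n})"
      unfolding r graph_spectral_radius_def by blast
  qed
qed simp

text \<open>Rayleigh quotient of the vector that is \<open>s\<close> on the hubs and 2 on the path.
  A path vertex has \<open>2 - 2 / m\<close> path neighbours on average, so this \<open>s\<close>
  makes the eigenvalue equation for \<open>t\<close> hold on average over the path. At a hub,
  \<open>small\<close> says that the neighbour sum \<open>s + 2 * m\<close> exceeds
  \<open>t * s\<close>.\<close>

lemma fan_graph_spectral_radius_gt:
  fixes t :: real
  assumes n: "n \<ge> 4" and t: "t \<ge> 2"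
    and small: "(t - 1) * (t - 2 + 2 / (real n - 2)) < 2 * (real n - 2)"
  shows "t < graph_spectral_radius (fan_graph n)"
proof -
  let ?G = "fan_graph n"
  define m where "m = real n - 2"
  define s where "s = t - 2 + 2 / m"
  have m: "m \<ge> 2" using n by (simp add: m_def)
  have s: "s > 0" using t m by (simp add: s_def add_nonneg_pos)
  define y where "y k = (if k < 2 then s else 2)" for k :: nat
  have V: "pverts ?G = {0, 1} \<union> {2..<n}" using n by (auto simp: fan_graph_def)
  have ne: "pverts ?G \<noteq> {}" unfolding V by simp
  have split: "(\<Sum>k\<in>pverts ?G. f k) = f 0 + f 1 + (\<Sum>k=2..<n. f k)" for f :: "nat \<Rightarrow> real"
    unfolding V by (subst sum.union_disjoint) auto
  have mn: "real (n - 2) = m" using n by (simp add: m_def)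
  have hub: "adjacent_sum ?G y k = s + 2 * m" if "k = 0 \<or> k = 1" for k
  proof -
    have "{v. v \<in> pverts ?G \<and> (k, v) \<in> parcs ?G} = insert (1 - k) {2..<n}"
      using that n by (auto simp: fan_graph_def)
    then have "adjacent_sum ?G y k = y (1 - k) + (\<Sum>v=2..<n. y v)"
      using that by (auto simp: adjacent_sum_def)
    also have "(\<Sum>v=2..<n. y v) = (\<Sum>v=2..<n. 2)" by (intro sum.cong) (auto simp: y_def)
    also have "y (1 - k) = s" using that by (auto simp: y_def)
    finally show ?thesis using mn by simp
  qed
  \<comment> \<open>Each of the ends 2 and \<open>n - 1\<close> lacks one path neighbour, of weight
    2.\<close>
  have path: "adjacent_sum ?G y k = 2 * s + 4 - (if k = 2 then 2 else 0) - (if k = n - 1 then 2 else 0)"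
    if k: "k \<in> {2..<n}" for k
  proof -
    have "{v. v \<in> pverts ?G \<and> (k, v) \<in> parcs ?G} =
        {0, 1} \<union> ((if k = 2 then {} else {k - 1}) \<union> (if k = n - 1 then {} else {k + 1}))"
      using k n by (auto simp: fan_graph_def)
    also have "sum y \<dots> = y 0 + y 1 + (\<Sum>v\<in>(if k = 2 then {} else {k - 1}). y v) + (\<Sum>v\<in>(if k = n - 1 then {} else {k + 1}). y v)"
      using k by (subst sum.union_disjoint) (auto simp: sum.union_disjoint)
    also have "\<dots> = 2 * s + 4 - (if k = 2 then 2 else 0) - (if k = n - 1 then 2 else 0)"
      using k by (auto simp: y_def)
    finally show ?thesis by (simp add: adjacent_sum_def)
  qed
  have "(\<Sum>k=2..<n. y k * adjacent_sum ?G y k) =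
      (\<Sum>k=2..<n. 2 * (2 * s + 4) - (if k = 2 then 4 else 0) - (if k = n - 1 then 4 else 0))"
    using path by (intro sum.cong) (auto simp: y_def)
  also have "\<dots> = m * (2 * (2 * s + 4)) - 8"
    using n mn by (simp add: sum_subtractf)
  finally have form: "(\<Sum>k\<in>pverts ?G. y k * adjacent_sum ?G y k) = 2 * s * s + 8 * m * s + 8 * m - 8"
    by (simp add: split hub) (simp add: y_def algebra_simps)
  have "(\<Sum>k=2..<n. (y k)\<^sup>2) = (\<Sum>k=2..<n. 4)"
    by (intro sum.cong) (auto simp: y_def)
  then have norm: "(\<Sum>k\<in>pverts ?G. (y k)\<^sup>2) = 2 * s * s + 4 * m"
    using mn by (simp add: split) (simp add: y_def power2_eq_square)
  have ms: "m * s = m * t - 2 * m + 2" using m by (simp add: s_def algebra_simps)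
  have "s * ((t - 1) * s) < s * (2 * m)"
    using small s by (intro mult_strict_left_mono) (simp_all add: s_def m_def)
  \<comment> \<open>Twice the preceding inequality plus
    \<open>4 * m * t = 4 * m * s + 8 * m - 8\<close>, which is \<open>ms\<close>.\<close>
  then have "t * (2 * s * s + 4 * m) < 2 * s * s + 8 * m * s + 8 * m - 8"
    using ms by (simp add: algebra_simps)
  also have "\<dots> \<le> graph_spectral_radius ?G * (2 * s * s + 4 * m)"
    unfolding form[symmetric] norm[symmetric]
    by (rule graph_spectral_radius_Perron[OF pair_graph_fan_graph ne]) auto
  finally show ?thesis
    using s m by (simp add: mult_less_cancel_right add_pos_pos)
qed

text \<open>\<open>M\<close> and \<open>w\<close> are numerical lower bounds for \<open>n - 2\<close> and \<open>sqrt (2 * n - 15 / 4)\<close>.\<close>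

lemma max_planar_spectral_radius_gt:
  fixes c M w :: real
  assumes n: "n \<ge> 4" and M: "0 < M" "M \<le> real n - 2" and w: "0 \<le> w" "w\<^sup>2 \<le> 2 * M + 1 / 4"
    and c: "1 \<le> c" "c \<le> 3 / 2"
    and num: "(c - 3 / 2)\<^sup>2 + 2 * (c - 1) / M < w * (3 - 2 * c - 2 / M)"
    and pos: "2 / M \<le> 3 - 2 * c"
  shows "c + sqrt (2 * real n - 15 / 4) < max_planar_spectral_radius n"
proof -
  define m where "m = real n - 2"
  define s where "s = sqrt (2 * real n - 15 / 4)"
  have m: "m \<ge> 2" "M \<le> m" using n M by (simp_all add: m_def)
  have ss: "s * s = 2 * m + 1 / 4"
    using n by (simp add: s_def m_def)
  have s_ge: "w \<le> s"
    unfolding s_def using w M by (intro real_le_rsqrt) simp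
  have "1 \<le> s"
    unfolding s_def using n by simp
  define k where "k = 2 / m"
  have inv: "k \<le> 2 / M" using m M by (simp add: k_def frac_le)
  have "(c - 3 / 2)\<^sup>2 + (c - 1) * k \<le> (c - 3 / 2)\<^sup>2 + (c - 1) * (2 / M)"
    using inv c by (intro add_left_mono mult_left_mono) auto
  also have "\<dots> < w * (3 - 2 * c - 2 / M)" using num by (simp add: mult.commute)
  also have "\<dots> \<le> s * (3 - 2 * c - k)"
    using s_ge inv w pos by (intro mult_mono) auto
  \<comment> \<open>Since \<open>(c - 1) * (c - 2) = (c - 3 / 2)\<^sup>2 - 1 / 4\<close>, this
    rearranges the chain above. As \<open>s * s - 1 / 4 = 2 * m\<close>, it is the condition
    \<open>small\<close> for \<open>t = c + s\<close>.\<close>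
  finally have "(c + s - 1) * (c + s - 2 + k) < s * s - 1 / 4"
    by (simp add: algebra_simps power2_eq_square)
  then have "c + s < graph_spectral_radius (fan_graph n)"
    using n c \<open>1 \<le> s\<close> ss by (intro fan_graph_spectral_radius_gt) (simp_all add: m_def k_def)
  also have "\<dots> \<le> max_planar_spectral_radius n"
    unfolding max_planar_spectral_radius_def
  proof (rule Max_ge[OF planar_spectral_radii_finite])
    have "card (pverts (fan_graph n)) = n" by (simp add: fan_graph_def)
    then show "graph_spectral_radius (fan_graph n) \<in> {graph_spectral_radius G | G :: nat pair_pre_digraph.
        pair_graph G \<and> planar G \<and> card (pverts G) = n}"
      using pair_graph_fan_graph planar_fan_graph by blast
  qed
  finally show ?thesis by (simp add: s_def)
qed

text \<open>Here and in the next two lemmas, \<open>M\<close> is \<open>n - 2\<close> for the least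
  admissible \<open>n\<close>, and \<open>w\<close> is the square root of
  \<open>2 * M + 1 / 4\<close> rounded down to two decimals.\<close>

lemma max_planar_spectral_radius_gt_10: "n \<ge> 10 \<Longrightarrow> 1.359 + sqrt (2 * real n - 15 / 4) < max_planar_spectral_radius n"
  by (rule max_planar_spectral_radius_gt[where M = 8 and w = "4.03"]) (auto simp: power2_eq_square)

lemma max_planar_spectral_radius_gt_40: "n \<ge> 40 \<Longrightarrow> 1.472 + sqrt (2 * real n - 15 / 4) < max_planar_spectral_radius n"
  by (rule max_planar_spectral_radius_gt[where M = 38 and w = "8.73"]) (auto simp: power2_eq_square)

lemma max_planar_spectral_radius_gt_50: "n \<ge> 50 \<Longrightarrow> 1.478 + sqrt (2 * real n - 15 / 4) < max_planar_spectral_radius n"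
  by (rule max_planar_spectral_radius_gt[where M = 48 and w = "9.81"]) (auto simp: power2_eq_square)

text \<open>The set is finite and contains the radius of the fan graph, so the maximum is attained
  and inherits the strict bound.\<close>

lemma max_planar_spectral_radius_less:
  assumes n: "n \<ge> 10"
  shows "max_planar_spectral_radius n < 2 + sqrt (2 * real n - 6)"
proof -
  let ?A = "{graph_spectral_radius G | G :: nat pair_pre_digraph. pair_graph G \<and> planar G \<and> card (pverts G) = n}"
  have "card (pverts (fan_graph n)) = n" by (simp add: fan_graph_def)
  then have "graph_spectral_radius (fan_graph n) \<in> ?A"
    using pair_graph_fan_graph planar_fan_graph by blast
  then have "Max ?A \<in> ?A" by (intro Max_in planar_spectral_radii_finite) auto
  then show ?thesis
    unfolding max_planar_spectral_radius_def using spectral_radius_planar_less n by fastforce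
qed

theorem theorem1p1:
  fixes n :: nat
  assumes "n > 0"
  shows "let \<rho> = max_planar_spectral_radius n in
    (n \<ge> 10 \<longrightarrow> 1.359 + sqrt (2 * real n - 15 / 4) < \<rho> \<and> \<rho> < 2 + sqrt (2 * real n - 6)) \<and>
    (n \<ge> 40 \<longrightarrow> 1.472 + sqrt (2 * real n - 15 / 4) < \<rho> \<and> \<rho> < 2 + sqrt (2 * real n - 6)) \<and>
    (n \<ge> 50 \<longrightarrow> 1.478 + sqrt (2 * real n - 15 / 4) < \<rho> \<and> \<rho> < 2 + sqrt (2 * real n - 6))"
  unfolding Let_def
  using max_planar_spectral_radius_gt_10[of n] max_planar_spectral_radius_gt_40[of n] max_planar_spectral_radius_gt_50[of n] max_planar_spectral_radius_less[of n] by simp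

end
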